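(* Let $p\ge1$ and $k\ge0$ be integers (of either parity). The monomials $\alpha^a\beta^b$ with integers $a,b\ge0$, $a+b=k$ and $a-b\equiv0\pmod p$, together with all their siblings (restricted to $S^3$), form a basis of the space of modes of wavenumber $k$ of the lens space $L(p,1)=S^3/Z_p$. This space has dimension $(2\lfloor k/p\rfloor+1)(k+1)$ if $p$ and $k$ are even; $0$ if $p$ is even and $k$ is odd; $(2\lfloor k/(2p)\rfloor+1)(k+1)$ if $p$ is odd and $k$ is even; $2(\lfloor (k-p)/(2p)\rfloor+1)(k+1)$ if $p$ and $k$ are odd. In particular for $p=2n$ the dimension is $(2\lfloor\frac{k/2}{n}\rfloor+1)(k+1)$ for even $k$ and $0$ for odd $k$.
   Context: Identify $\mathbb R^4$ with $\mathbb C^2$ via $\alpha=x+iy$, $\beta=z+iw$, $S^3=\{|\alpha|^2+|\beta|^2=1\}$. Wirtinger derivatives $\frac{\partial}{\partial\alpha}=\frac12(\partial_x-i\partial_y)$, similarly for $\beta$ with $(z,w)$. $\mathrm{twist}_-=-\bar\beta\frac{\partial}{\partial\alpha}+\bar\alpha\frac{\partial}{\partial\beta}$. For a polynomial $f$ in $\alpha,\beta$ only, homogeneous of degree $k$, its siblings are $\mathrm{twist}_-^j f$, $j=0,\dots,k$. $\gamma\in SU(2)$ acts on $\mathbb C^2$ by $(\alpha,\beta)^T\mapsto\gamma(\alpha,\beta)^T$ and on functions by $(R_\gamma F)(x)=F(\gamma^{-1}x)$. For a finite subgroup $\Gamma\subset SU(2)$, the space of modes of wavenumber $k$ of $S^3/\Gamma$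 is the complex vector space of $\Gamma$-invariant $F:S^3\to\mathbb C$ with $\Delta_{S^3}F=-k(k+2)F$. $Z_p\subset SU(2)$ is the cyclic group generated by $\mathrm{diag}(e^{2\pi i/p},e^{-2\pi i/p})$, and $L(p,1)=S^3/Z_p$. *)

theory Defs
  imports "HOL-Analysis.Analysis" "HOL-Library.Function_Algebras"
begin

text \<open>Points of C^2 = R^4 are pairs (alpha, beta); alpha = x + i y, beta = z + i w.
  complex \<times> complex carries the Euclidean norm sqrt(|alpha|^2+|beta|^2).\<close>

type_synonym pt = "complex \<times> complex"

definition S3 :: "pt set" where
  "S3 = {v. norm v = 1}"

definition d_x :: "(pt \<Rightarrow> complex) \<Rightarrow> pt \<Rightarrow> complex" where
  "d_x F v = vector_derivative (\<lambda>t::real. F (fst v + complex_of_real t, snd v)) (at 0)"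
definition d_y :: "(pt \<Rightarrow> complex) \<Rightarrow> pt \<Rightarrow> complex" where
  "d_y F v = vector_derivative (\<lambda>t::real. F (fst v + \<i> * complex_of_real t, snd v)) (at 0)"
definition d_z :: "(pt \<Rightarrow> complex) \<Rightarrow> pt \<Rightarrow> complex" where
  "d_z F v = vector_derivative (\<lambda>t::real. F (fst v, snd v + complex_of_real t)) (at 0)"
definition d_w :: "(pt \<Rightarrow> complex) \<Rightarrow> pt \<Rightarrow> complex" where
  "d_w F v = vector_derivative (\<lambda>t::real. F (fst v, snd v + \<i> * complex_of_real t)) (at 0)"

definition d_alpha :: "(pt \<Rightarrow> complex) \<Rightarrow> pt \<Rightarrow> complex" where
  "d_alpha F v = (d_x F v - \<i> * d_y F v) / 2"
definition d_beta :: "(pt \<Rightarrow> complex) \<Rightarrow> pt \<Rightarrow> complex" where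
  "d_beta F v = (d_z F v - \<i> * d_w F v) / 2"

definition twist_minus :: "(pt \<Rightarrow> complex) \<Rightarrow> pt \<Rightarrow> complex" where
  "twist_minus F v = - cnj (snd v) * d_alpha F v + cnj (fst v) * d_beta F v"

definition monomial :: "nat \<Rightarrow> nat \<Rightarrow> pt \<Rightarrow> complex" where
  "monomial a b v = fst v ^ a * snd v ^ b"

text \<open>Functions on S^3 are represented canonically by functions pt => complex
  vanishing outside S^3.\<close>
definition restrS3 :: "(pt \<Rightarrow> complex) \<Rightarrow> pt \<Rightarrow> complex" where
  "restrS3 F v = (if v \<in> S3 then F v else 0)"

text \<open>Laplace-Beltrami operator of S^3: Delta_{S^3} F is the Euclidean Laplacian of the
  degree-0 homogeneous extension v |-> F(v/|v|), evaluated on S^3.  We require this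
  extension to be C^2 on R^4 - {0} (G', G'' first and second Frechet derivatives) and
  the Laplacian is the trace of the second derivative over the orthonormal basis.\<close>
definition hom_ext :: "(pt \<Rightarrow> complex) \<Rightarrow> pt \<Rightarrow> complex" where
  "hom_ext F v = F (scaleR (inverse (norm v)) v)"

definition S3_laplace_eigen :: "(pt \<Rightarrow> complex) \<Rightarrow> complex \<Rightarrow> bool" where
  "S3_laplace_eigen F c \<longleftrightarrow>
     (\<exists>(G' :: pt \<Rightarrow> pt \<Rightarrow>\<^sub>L complex) (G'' :: pt \<Rightarrow> pt \<Rightarrow>\<^sub>L (pt \<Rightarrow>\<^sub>L complex)).
        (\<forall>v. v \<noteq> 0 \<longrightarrow> (hom_ext F has_derivative blinfun_apply (G' v)) (at v)) \<and>
        (\<forall>v. v \<noteq> 0 \<longrightarrow> (G' has_derivative blinfun_apply (G'' v)) (at v)) \<and>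
        continuous_on (- {0}) G'' \<and>
        (\<forall>x\<in>S3. (\<Sum>b\<in>Basis. blinfun_apply (blinfun_apply (G'' x) b) b) = c * F x))"

definition Zp_gen :: "nat \<Rightarrow> pt \<Rightarrow> pt" where
  "Zp_gen p v = (cis (2 * pi / real p) * fst v, cis (- 2 * pi / real p) * snd v)"

definition Zp :: "nat \<Rightarrow> (pt \<Rightarrow> pt) set" where
  "Zp p = {(Zp_gen p) ^^ m | m. True}"

definition R_act :: "(pt \<Rightarrow> pt) \<Rightarrow> (pt \<Rightarrow> complex) \<Rightarrow> pt \<Rightarrow> complex" where
  "R_act \<gamma> F x = F (inv \<gamma> x)"

definition modes :: "(pt \<Rightarrow> pt) set \<Rightarrow> nat \<Rightarrow> (pt \<Rightarrow> complex) set" where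
  "modes \<Gamma> k = {F. (\<forall>x. x \<notin> S3 \<longrightarrow> F x = 0) \<and>
                     (\<forall>\<gamma>\<in>\<Gamma>. \<forall>x\<in>S3. R_act \<gamma> F x = F x) \<and>
                     S3_laplace_eigen F (- of_nat (k * (k + 2)))}"

definition fscale :: "complex \<Rightarrow> (pt \<Rightarrow> complex) \<Rightarrow> pt \<Rightarrow> complex" where
  "fscale c F = (\<lambda>x. c * F x)"

end

theory Submission
  imports Defs "HOL-Computational_Algebra.Polynomial"
begin

text \<open>The operator twist_- is a derivation with alpha \<mapsto> - cnj beta, beta \<mapsto> cnj alpha that kills
  cnj alpha and cnj beta, so the siblings of alpha^a beta^b are, up to factorials, the coefficients
  of the powers of t in (alpha - t cnj beta)^a (beta + t cnj alpha)^b. These are harmonic and homogeneous of degree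
  a + b, hence restrict to eigenfunctions. On the sphere the relation
  cnj alpha (alpha - t cnj beta) + cnj beta (beta + t cnj alpha) = 1 shows that the span of all of
  them is closed under multiplication by the coordinates, so it contains every polynomial and is dense.
  Green's identity, integrated over an annulus with a radial cutoff, makes eigenfunctions for distinct eigenvalues
  orthogonal; an eigenfunction minus its projection to the siblings of its own degree is therefore
  orthogonal to a dense subspace and vanishes. Finally, the siblings have pairwise distinct
  weights (a - j, b - j) under the maximal torus, which gives independence and, since the
  generator of Z_p acts by the root of unity with exponent a - b, picks out the invariant ones.\<close>

section \<open>Siblings as coefficients of a generating polynomial\<close>

text \<open>The Laplacian is defined through the degree-0 extension to the punctured space, and this
  decides the analysis. Averaging that extension over 1 <= |v| <= 2 with a radial weight is, up to a
  positive constant, integration over the sphere. So Lebesgue measure on C^2 suffices, and the only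
  integral theorem involved is that a directional derivative of a compactly supported function
  integrates to 0. Explicit eigenfunctions bound an eigenspace only from below; the bound from above
  comes from density. If F has degree k and P is its projection, then F - P is again an
  eigenfunction of degree k, so its orthogonality to all other degrees is automatic and only a
  finite family has to be projected away. The obstacle to density is multiplication by the conjugate
  coordinates: the product with a sibling is in general not harmonic, but on the sphere it splits
  into one sibling of degree one lower and one of degree one higher. Independence stays algebraic:
  no norm of a sibling is ever computed.\<close>

definition sib_poly :: "nat \<Rightarrow> nat \<Rightarrow> pt \<Rightarrow> complex poly" where
  "sib_poly a b v = [:fst v, - cnj (snd v):] ^ a * [:snd v, cnj (fst v):] ^ b"

definition sib :: "nat \<Rightarrow> nat \<Rightarrow> nat \<Rightarrow> pt \<Rightarrow> complex" where
  "sib a b j v = coeff (sib_poly a b v) j"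

text \<open>The coefficient with index j - 1, read as 0 at j = 0. Multiplying by t through
  \<open>pCons 0\<close> gives this convention, whereas truncated subtraction would return the
  coefficient 0 again.\<close>

definition sib_lag :: "nat \<Rightarrow> nat \<Rightarrow> nat \<Rightarrow> pt \<Rightarrow> complex" where
  "sib_lag a b j v = coeff (pCons 0 (sib_poly a b v)) j"

lemma sib_lag_simps [simp]: "sib_lag a b 0 v = 0" "sib_lag a b (Suc j) v = sib a b j v"
  by (simp_all add: sib_lag_def sib_def)

lemma coeff_mult_linear:
  "coeff (p * [:x, y:]) j = x * coeff p j + y * coeff (pCons 0 p) j" for p :: "'a::comm_semiring_1 poly"
  by (cases j) (simp_all add: mult.commute[of p])

lemma sib_Suc_left: "sib (Suc a) b j v = fst v * sib a b j v - cnj (snd v) * sib_lag a b j v"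
proof -
  have "sib_poly (Suc a) b v = sib_poly a b v * [:fst v, - cnj (snd v):]"
    by (simp only: sib_poly_def power_Suc mult_ac)
  then show ?thesis by (simp add: sib_def sib_lag_def coeff_mult_linear del: mult_pCons_right)
qed

lemma sib_Suc_right: "sib a (Suc b) j v = snd v * sib a b j v + cnj (fst v) * sib_lag a b j v"
proof -
  have "sib_poly a (Suc b) v = sib_poly a b v * [:snd v, cnj (fst v):]"
    by (simp only: sib_poly_def power_Suc mult_ac)
  then show ?thesis by (simp add: sib_def sib_lag_def coeff_mult_linear del: mult_pCons_right)
qed

lemma sib_0: "sib a b 0 = monomial a b"
  by (rule ext) (simp add: sib_def sib_poly_def monomial_def coeff_mult_0 coeff_0_power)

lemma sib_0_0: "sib 0 0 j v = (if j = 0 then 1 else 0)"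
  by (simp add: sib_def sib_poly_def)

lemma degree_sib_poly: "degree (sib_poly a b v) \<le> a + b"
proof -
  have "degree ([:x, y:] ^ n) \<le> n" for x y :: complex and n
    using degree_power_le[of "[:x, y:]" n] by (simp split: if_splits)
  then show ?thesis unfolding sib_poly_def
    by (meson add_mono degree_mult_le le_trans)
qed

lemma sib_eq_0: "j > a + b \<Longrightarrow> sib a b j v = 0"
  unfolding sib_def using degree_sib_poly[of a b v] by (intro coeff_eq_0) linarith

lemma pderiv_sib_poly:
  "pderiv (sib_poly a b v)
     = smult (of_nat b * cnj (fst v)) (sib_poly a (b - 1) v) - smult (of_nat a * cnj (snd v)) (sib_poly (a - 1) b v)"
  by (simp only: sib_poly_def pderiv_mult pderiv_power pderiv_pCons)
     (simp add: mult_ac)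

text \<open>Compares coefficients of t^j in the t-derivative of the generating polynomial. The right
  side is also what \<open>twist_minus\<close> makes of \<open>sib a b j\<close>, so a twist is a
  shift of j. At a = 0 or b = 0 the truncated exponent is harmless, its factor being 0.\<close>

lemma Suc_sib_Suc:
  "of_nat (Suc j) * sib a b (Suc j) v
     = of_nat b * cnj (fst v) * sib a (b - 1) j v - of_nat a * cnj (snd v) * sib (a - 1) b j v"
proof -
  have "of_nat (Suc j) * sib a b (Suc j) v = coeff (pderiv (sib_poly a b v)) j"
    by (simp add: sib_def coeff_pderiv)
  then show ?thesis by (simp only: pderiv_sib_poly) (simp add: sib_def)
qed

section \<open>Real derivatives of the siblings\<close>

definition dsib :: "nat \<Rightarrow> nat \<Rightarrow> nat \<Rightarrow> pt \<Rightarrow> pt \<Rightarrow> complex" where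
  "dsib a b j v h =
     of_nat a * (fst h * sib (a - 1) b j v - cnj (snd h) * sib_lag (a - 1) b j v)
   + of_nat b * (snd h * sib a (b - 1) j v + cnj (fst h) * sib_lag a (b - 1) j v)"

definition dsib_lag :: "nat \<Rightarrow> nat \<Rightarrow> nat \<Rightarrow> pt \<Rightarrow> pt \<Rightarrow> complex" where
  "dsib_lag a b j v h = (case j of 0 \<Rightarrow> 0 | Suc i \<Rightarrow> dsib a b i v h)"

text \<open>The product rule applied to the recursion \<open>sib_Suc_left\<close>; it identifies the
  derivative in the induction step on a.\<close>

lemma dsib_Suc_left:
  "dsib (Suc a) b j v h = fst v * dsib a b j v h - cnj (snd v) * dsib_lag a b j v h
     + (fst h * sib a b j v - cnj (snd h) * sib_lag a b j v)"
proof -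
  have *: "of_nat b * (snd h * sib (Suc a) (b - 1) j v + cnj (fst h) * sib_lag (Suc a) (b - 1) j v)
     = fst v * (of_nat b * (snd h * sib a (b - 1) j v + cnj (fst h) * sib_lag a (b - 1) j v))
       - cnj (snd v) * (case j of 0 \<Rightarrow> 0 | Suc i \<Rightarrow>
           of_nat b * (snd h * sib a (b - 1) i v + cnj (fst h) * sib_lag a (b - 1) i v))"
    by (cases j) (simp_all add: sib_Suc_left algebra_simps)
  \<comment> \<open>The case split on a is due to the truncated a - 1: both sides are 0 for a = 0,
    and otherwise the recursion applies to the predecessor.\<close>
  have **: "of_nat a * (fst h * sib a b j v - cnj (snd h) * sib_lag a b j v)
     = fst v * (of_nat a * (fst h * sib (a - 1) b j v - cnj (snd h) * sib_lag (a - 1) b j v))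
       - cnj (snd v) * (case j of 0 \<Rightarrow> 0 | Suc i \<Rightarrow>
           of_nat a * (fst h * sib (a - 1) b i v - cnj (snd h) * sib_lag (a - 1) b i v))"
    by (cases a; cases j) (simp_all add: sib_Suc_left algebra_simps)
  have "dsib (Suc a) b j v h = (fst h * sib a b j v - cnj (snd h) * sib_lag a b j v) + of_nat a * (fst h * sib a b j v - cnj (snd h) * sib_lag a b j v)
     + of_nat b * (snd h * sib (Suc a) (b - 1) j v + cnj (fst h) * sib_lag (Suc a) (b - 1) j v)"
    by (simp add: dsib_def distrib_right)
  then show ?thesis unfolding * **
    by (cases j) (simp_all add: dsib_def dsib_lag_def algebra_simps)
qed

lemma dsib_Suc_right:
  "dsib a (Suc b) j v h = snd v * dsib a b j v h + cnj (fst v) * dsib_lag a b j v h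
     + (snd h * sib a b j v + cnj (fst h) * sib_lag a b j v)"
proof -
  have *: "of_nat a * (fst h * sib (a - 1) (Suc b) j v - cnj (snd h) * sib_lag (a - 1) (Suc b) j v)
     = snd v * (of_nat a * (fst h * sib (a - 1) b j v - cnj (snd h) * sib_lag (a - 1) b j v))
       + cnj (fst v) * (case j of 0 \<Rightarrow> 0 | Suc i \<Rightarrow>
           of_nat a * (fst h * sib (a - 1) b i v - cnj (snd h) * sib_lag (a - 1) b i v))"
    by (cases j) (simp_all add: sib_Suc_right algebra_simps)
  have **: "of_nat b * (snd h * sib a b j v + cnj (fst h) * sib_lag a b j v)
     = snd v * (of_nat b * (snd h * sib a (b - 1) j v + cnj (fst h) * sib_lag a (b - 1) j v))
       + cnj (fst v) * (case j of 0 \<Rightarrow> 0 | Suc i \<Rightarrow>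
           of_nat b * (snd h * sib a (b - 1) i v + cnj (fst h) * sib_lag a (b - 1) i v))"
    by (cases b; cases j) (simp_all add: sib_Suc_right algebra_simps)
  have "dsib a (Suc b) j v h = (snd h * sib a b j v + cnj (fst h) * sib_lag a b j v) + of_nat b * (snd h * sib a b j v + cnj (fst h) * sib_lag a b j v)
     + of_nat a * (fst h * sib (a - 1) (Suc b) j v - cnj (snd h) * sib_lag (a - 1) (Suc b) j v)"
    by (simp add: dsib_def distrib_right)
  then show ?thesis unfolding * **
    by (cases j) (simp_all add: dsib_def dsib_lag_def algebra_simps)
qed

lemma has_derivative_sib_lag:
  assumes "\<And>j. (sib a b j has_derivative dsib a b j v) (at v)"
  shows "(sib_lag a b j has_derivative dsib_lag a b j v) (at v)"
proof (cases j)
  case 0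
  then show ?thesis using has_derivative_const[of 0 "at v"]
    by (simp add: dsib_lag_def[abs_def] sib_lag_def[abs_def])
next
  case (Suc i)
  have "sib_lag a b j = sib a b i" "dsib_lag a b j v = dsib a b i v"
    by (auto simp: Suc dsib_lag_def)
  then show ?thesis using assms by simp
qed

lemma has_derivative_sib: "(sib a b j has_derivative dsib a b j v) (at v)"
proof (induction a arbitrary: j)
  case 0
  show ?case
  proof (induction b arbitrary: j)
    case 0
    have "sib 0 0 j = (\<lambda>v. if j = 0 then 1 else 0)" "dsib 0 0 j v = (\<lambda>h. 0)"
      by (auto simp: sib_0_0 dsib_def)
    then show ?case by simp
  next
    case (Suc b)
    have e: "sib 0 (Suc b) j = (\<lambda>v. snd v * sib 0 b j v + cnj (fst v) * sib_lag 0 b j v)"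
      by (rule ext) (rule sib_Suc_right)
    show ?case unfolding e
      by (rule has_derivative_eq_rhs, (rule derivative_intros Suc has_derivative_sib_lag)+)
         (auto simp: fun_eq_iff dsib_Suc_right algebra_simps)
  qed
next
  case (Suc a)
  have e: "sib (Suc a) b j = (\<lambda>v. fst v * sib a b j v - cnj (snd v) * sib_lag a b j v)"
    by (rule ext) (rule sib_Suc_left)
  show ?case unfolding e
    by (rule has_derivative_eq_rhs, (rule derivative_intros Suc has_derivative_sib_lag)+)
       (auto simp: fun_eq_iff dsib_Suc_left algebra_simps)
qed

lemmas has_derivative_sib_lag' = has_derivative_sib_lag[OF has_derivative_sib]

section \<open>Wirtinger derivatives and the twist\<close>

lemma twist_minus_eq:
  assumes "(F has_derivative D) (at v)"
  shows "twist_minus F v = (- cnj (snd v) * (D (1, 0) - \<i> * D (\<i>, 0)) + cnj (fst v) * (D (0, 1) - \<i> * D (0, \<i>))) / 2"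
proof -
  have *: "vector_derivative (\<lambda>t::real. F (g t)) (at 0) = D e" if "(g has_derivative (\<lambda>t. t *\<^sub>R e)) (at 0)" "g 0 = v" for g e
  proof -
    have "(F has_derivative D) (at (g 0))" using that assms by simp
    from has_derivative_compose[OF that(1) this]
    have "((\<lambda>t. F (g t)) has_derivative (\<lambda>t. D (t *\<^sub>R e))) (at 0)" .
    moreover have "D (t *\<^sub>R e) = t *\<^sub>R D e" for t
      using assms has_derivative_linear linear_scale by blast
    ultimately show ?thesis
      by (intro vector_derivative_at) (simp add: has_vector_derivative_def)
  qed
  have "d_x F v = D (1, 0)" unfolding d_x_def
    by (rule *) (auto intro!: derivative_eq_intros simp: fun_eq_iff scaleR_conv_of_real)
  moreover have "d_y F v = D (\<i>, 0)" unfolding d_y_def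
    by (rule *) (auto intro!: derivative_eq_intros simp: fun_eq_iff scaleR_conv_of_real)
  moreover have "d_z F v = D (0, 1)" unfolding d_z_def
    by (rule *) (auto intro!: derivative_eq_intros simp: fun_eq_iff scaleR_conv_of_real)
  moreover have "d_w F v = D (0, \<i>)" unfolding d_w_def
    by (rule *) (auto intro!: derivative_eq_intros simp: fun_eq_iff scaleR_conv_of_real)
  ultimately show ?thesis by (simp add: twist_minus_def d_alpha_def d_beta_def add_divide_distrib)
qed

text \<open>The combinations D(1,0) - i D(i,0) and D(0,1) - i D(0,i) kill the conjugate-linear terms
  of \<open>dsib\<close>, and the rest is the right side of \<open>Suc_sib_Suc\<close>. The scalar c
  is carried along so that the factors Suc j can accumulate to a factorial under iteration.\<close>

lemma twist_minus_scaled_sib: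
  "twist_minus (\<lambda>v. c * sib a b j v) = (\<lambda>v. c * of_nat (Suc j) * sib a b (Suc j) v)"
proof
  fix v
  have "((\<lambda>v. c * sib a b j v) has_derivative (\<lambda>h. c * dsib a b j v h)) (at v)"
    by (rule has_derivative_mult_right[OF has_derivative_sib])
  note tw = twist_minus_eq[OF this]
  have "twist_minus (\<lambda>v. c * sib a b j v) v
    = c * (of_nat b * cnj (fst v) * sib a (b - 1) j v - of_nat a * cnj (snd v) * sib (a - 1) b j v)"
    unfolding tw by (simp add: dsib_def field_simps)
  then show "twist_minus (\<lambda>v. c * sib a b j v) v = c * of_nat (Suc j) * sib a b (Suc j) v"
    by (simp only: mult.assoc Suc_sib_Suc)
qed

lemma funpow_twist_minus_monomial: "(twist_minus ^^ j) (monomial a b) = (\<lambda>v. fact j * sib a b j v)"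
  by (induction j) (simp_all add: sib_0 twist_minus_scaled_sib algebra_simps)

section \<open>Homogeneity and harmonicity of the siblings\<close>

lemma sum_Basis_pt: "sum f (Basis :: pt set) = f (1, 0) + f (\<i>, 0) + f (0, 1) + f (0, \<i>)"
  by (simp add: Basis_prod_def Basis_complex_def image_Un add_ac)

lemma sib_scaleR: "sib a b j (t *\<^sub>R v) = of_real (t ^ (a + b)) * sib a b j v"
proof -
  have *: "[:t *\<^sub>R x, t *\<^sub>R y:] ^ n = smult (of_real (t ^ n)) ([:x, y:] ^ n)" for x y :: complex and n
  proof -
    have "[:t *\<^sub>R x, t *\<^sub>R y:] = smult (of_real t) [:x, y:]" by (simp add: scaleR_conv_of_real)
    then show ?thesis by (simp only: smult_power[symmetric] of_real_power)
  qed
  have "sib_poly a b (t *\<^sub>R v) = smult (of_real (t ^ (a + b))) (sib_poly a b v)"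
    using *[of "fst v" "- cnj (snd v)" a] *[of "snd v" "cnj (fst v)" b]
    by (simp add: sib_poly_def power_add scaleR_conv_of_real mult.commute)
  then show ?thesis by (simp add: sib_def)
qed

text \<open>With h = v each bracket of \<open>dsib\<close> is the recursion that restores the
  missing factor, so both brackets equal the sibling itself.\<close>

lemma dsib_Euler: "dsib a b j v v = of_nat (a + b) * sib a b j v"
proof -
  have "of_nat a * (fst v * sib (a - 1) b j v - cnj (snd v) * sib_lag (a - 1) b j v) = of_nat a * sib a b j v"
    by (cases a) (simp_all add: sib_Suc_left)
  moreover have "of_nat b * (snd v * sib a (b - 1) j v + cnj (fst v) * sib_lag a (b - 1) j v) = of_nat b * sib a b j v"
    by (cases b) (simp_all add: sib_Suc_right)
  ultimately show ?thesis by (simp add: dsib_def algebra_simps)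
qed

definition d2sib :: "nat \<Rightarrow> nat \<Rightarrow> nat \<Rightarrow> pt \<Rightarrow> pt \<Rightarrow> pt \<Rightarrow> complex" where
  "d2sib a b j h v g =
     of_nat a * (fst h * dsib (a - 1) b j v g - cnj (snd h) * dsib_lag (a - 1) b j v g)
   + of_nat b * (snd h * dsib a (b - 1) j v g + cnj (fst h) * dsib_lag a (b - 1) j v g)"

lemma has_derivative_dsib: "((\<lambda>v. dsib a b j v h) has_derivative d2sib a b j h v) (at v)"
  unfolding dsib_def
  by (rule has_derivative_eq_rhs, (rule derivative_intros has_derivative_sib has_derivative_sib_lag')+)
     (auto simp: fun_eq_iff d2sib_def algebra_simps)

lemma continuous_on_sib: "continuous_on S (sib a b j)"
  by (intro continuous_at_imp_continuous_on ballI has_derivative_continuous[OF has_derivative_sib])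

lemma continuous_on_sib_lag: "continuous_on S (sib_lag a b j)"
  by (intro continuous_at_imp_continuous_on ballI has_derivative_continuous[OF has_derivative_sib_lag'])

lemma continuous_on_dsib: "continuous_on S (\<lambda>v. dsib a b j v h)"
  unfolding dsib_def by (intro continuous_intros continuous_on_sib continuous_on_sib_lag)

lemma continuous_on_d2sib: "continuous_on S (\<lambda>v. d2sib a b j h v g)"
proof -
  have "continuous_on S (\<lambda>v. dsib_lag a b j v g)" for a b
    unfolding dsib_lag_def by (cases j) (simp_all add: continuous_on_dsib)
  then show ?thesis unfolding d2sib_def by (intro continuous_intros continuous_on_dsib)
qed

text \<open>Only mixed derivatives by a coordinate and its conjugate survive. In the generating
  polynomial alpha sits in one factor and t cnj alpha in the other, giving 4 a b t times the product
  with both exponents lowered; for beta the term is -t cnj beta, giving the negative.\<close>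

lemma d2sib_trace: "(\<Sum>e\<in>Basis. d2sib a b j e v e) = 0"
  unfolding sum_Basis_pt
  by (cases j) (simp_all add: d2sib_def dsib_def dsib_lag_def algebra_simps)

section \<open>Laplace eigenfunctions in coordinates\<close>

text \<open>The C^2 condition on the extension, expressed by complex-valued partial derivatives:
  \<open>D v e\<close> is the first derivative in direction e, and \<open>D2 e v g\<close>
  differentiates it in direction g.\<close>

definition hom_partials ::
  "(pt \<Rightarrow> complex) \<Rightarrow> (pt \<Rightarrow> pt \<Rightarrow> complex) \<Rightarrow> (pt \<Rightarrow> pt \<Rightarrow> pt \<Rightarrow> complex) \<Rightarrow> bool" where
  "hom_partials F D D2 \<longleftrightarrow>
     (\<forall>v. v \<noteq> 0 \<longrightarrow> (hom_ext F has_derivative D v) (at v)) \<and>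
     (\<forall>e\<in>Basis. \<forall>v. v \<noteq> 0 \<longrightarrow> ((\<lambda>v. D v e) has_derivative D2 e v) (at v)) \<and>
     (\<forall>e\<in>Basis. \<forall>g\<in>Basis. continuous_on (- {0}) (\<lambda>v. D2 e v g))"

lemma linear_eq_sum_Basis:
  fixes f :: "'a::euclidean_space \<Rightarrow> 'b::real_vector"
  assumes "linear f"
  shows "f h = (\<Sum>e\<in>Basis. (h \<bullet> e) *\<^sub>R f e)"
proof -
  have "f h = f (\<Sum>e\<in>Basis. (h \<bullet> e) *\<^sub>R e)" by (simp add: euclidean_representation)
  also have "\<dots> = (\<Sum>e\<in>Basis. (h \<bullet> e) *\<^sub>R f e)"
    by (simp add: linear_sum[OF assms] linear_scale[OF assms])
  finally show ?thesis .
qed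

text \<open>The rank-one operator with value z along e. Being linear in z, it lets operator-valued
  derivatives be reassembled from their coordinates.\<close>

definition blinfun_coord :: "'a::euclidean_space \<Rightarrow> 'b::real_normed_vector \<Rightarrow> 'a \<Rightarrow>\<^sub>L 'b" where
  "blinfun_coord e z = blinfun_scaleR_left z o\<^sub>L blinfun_inner_right e"

lemma blinfun_coord_apply [simp]: "blinfun_apply (blinfun_coord e z) h = (e \<bullet> h) *\<^sub>R z"
  by (simp add: blinfun_coord_def)

lemma bounded_linear_blinfun_coord: "bounded_linear (blinfun_coord e)"
  unfolding blinfun_coord_def[abs_def]
  by (rule bounded_linear_compose[OF bounded_bilinear.bounded_linear_left[OF bounded_bilinear_blinfun_compose] bounded_linear_blinfun_scaleR_left])

text \<open>In finite dimension a derivative is the sum of its rank-one coordinate parts, so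
  operator-valued derivatives exist and are continuous exactly when the coordinate ones are. All
  later calculus can thus use scalar product and chain rules.\<close>

lemma S3_laplace_eigen_iff:
  "S3_laplace_eigen F c \<longleftrightarrow>
     (\<exists>D D2. hom_partials F D D2 \<and> (\<forall>x\<in>S3. (\<Sum>e\<in>Basis. D2 e x e) = c * F x))" (is "?L \<longleftrightarrow> ?R")
proof
  assume ?L
  then obtain G' :: "pt \<Rightarrow> pt \<Rightarrow>\<^sub>L complex" and G'' :: "pt \<Rightarrow> pt \<Rightarrow>\<^sub>L (pt \<Rightarrow>\<^sub>L complex)" where
    G: "\<And>v. v \<noteq> 0 \<Longrightarrow> (hom_ext F has_derivative blinfun_apply (G' v)) (at v)"
       "\<And>v. v \<noteq> 0 \<Longrightarrow> (G' has_derivative blinfun_apply (G'' v)) (at v)"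
       "continuous_on (- {0}) G''"
       "\<And>x. x \<in> S3 \<Longrightarrow> (\<Sum>b\<in>Basis. blinfun_apply (blinfun_apply (G'' x) b) b) = c * F x"
    unfolding S3_laplace_eigen_def by blast
  have "hom_partials F (\<lambda>v. blinfun_apply (G' v)) (\<lambda>e v h. blinfun_apply (blinfun_apply (G'' v) h) e)"
    unfolding hom_partials_def
  proof (intro conjI allI impI ballI)
    fix e v :: pt assume "v \<noteq> 0"
    then show "((\<lambda>v. blinfun_apply (G' v) e) has_derivative (\<lambda>h. blinfun_apply (blinfun_apply (G'' v) h) e)) (at v)"
      by (intro bounded_linear.has_derivative[OF blinfun.bounded_linear_left] G(2))
  qed (auto intro!: G continuous_intros)
  then show ?R using G(4) by blast
next
  assume ?R
  then obtain D D2 where H: "hom_partials F D D2" and tr: "\<And>x. x \<in> S3 \<Longrightarrow> (\<Sum>e\<in>Basis. D2 e x e) = c * F x"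
    by blast
  define G' where "G' v = (\<Sum>e\<in>Basis. blinfun_coord e (D v e))" for v
  define G'' where "G'' v = (\<Sum>g\<in>Basis. blinfun_coord g (\<Sum>e\<in>Basis. blinfun_coord e (D2 e v g)))" for v
  have G'_apply: "blinfun_apply (G' v) = D v" if "v \<noteq> 0" for v
  proof
    fix h
    have "linear (D v)" using H that has_derivative_linear unfolding hom_partials_def by blast
    from linear_eq_sum_Basis[OF this, of h]
    show "blinfun_apply (G' v) h = D v h"
      by (simp add: G'_def blinfun.sum_left inner_commute)
  qed
  have G''_apply: "blinfun_apply (G'' v) h = (\<Sum>e\<in>Basis. blinfun_coord e (D2 e v h))" if "v \<noteq> 0" for v h
  proof -
    have "linear (D2 e v)" if "e \<in> Basis" for e
      using H \<open>v \<noteq> 0\<close> that has_derivative_linear unfolding hom_partials_def by blast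
    then have "blinfun_coord e (D2 e v h) = (\<Sum>g\<in>Basis. (h \<bullet> g) *\<^sub>R blinfun_coord e (D2 e v g))" if "e \<in> Basis" for e
      using linear_eq_sum_Basis[OF linear_compose, of "D2 e v" "blinfun_coord e" h] that
        bounded_linear.linear[OF bounded_linear_blinfun_coord[of e]]
      by (simp add: o_def)
    then have "(\<Sum>e\<in>Basis. blinfun_coord e (D2 e v h))
        = (\<Sum>e\<in>Basis. \<Sum>g\<in>Basis. (h \<bullet> g) *\<^sub>R blinfun_coord e (D2 e v g))"
      by (intro sum.cong) auto
    also have "\<dots> = blinfun_apply (G'' v) h"
      by (subst sum.swap) (simp add: G''_def blinfun.sum_left inner_commute scaleR_sum_right)
    finally show ?thesis ..
  qed
  show ?L unfolding S3_laplace_eigen_def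
  proof (intro exI conjI allI impI ballI)
    fix v :: pt assume v: "v \<noteq> 0"
    show "(hom_ext F has_derivative blinfun_apply (G' v)) (at v)"
      using H v unfolding hom_partials_def G'_apply[OF v] by blast
    have "(G' has_derivative (\<lambda>h. \<Sum>e\<in>Basis. blinfun_coord e (D2 e v h))) (at v)"
      unfolding G'_def[abs_def] using H v unfolding hom_partials_def
      by (intro has_derivative_sum bounded_linear.has_derivative[OF bounded_linear_blinfun_coord]) blast
    then show "(G' has_derivative blinfun_apply (G'' v)) (at v)"
      using G''_apply[OF v] by (metis (no_types, lifting) ext has_derivative_eq_rhs)
  next
    show "continuous_on (- {0}) G''"
      unfolding G''_def using H unfolding hom_partials_def
      by (intro continuous_on_sum bounded_linear.continuous_on[OF bounded_linear_blinfun_coord]) auto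
  next
    fix x assume x: "x \<in> S3"
    then have "x \<noteq> 0" by (auto simp: S3_def)
    have "(\<Sum>b\<in>Basis. blinfun_apply (blinfun_apply (G'' x) b) b)
       = (\<Sum>b\<in>Basis. \<Sum>e\<in>Basis. (e \<bullet> b) *\<^sub>R D2 e x b)"
      by (simp add: G''_apply[OF \<open>x \<noteq> 0\<close>] blinfun.sum_left)
    also have "\<dots> = (\<Sum>b\<in>Basis. \<Sum>e\<in>Basis. if e = b then D2 b x b else 0)"
      by (intro sum.cong refl) (auto simp: inner_Basis)
    also have "\<dots> = c * F x"
      using tr[OF x] by (simp add: sum.delta)
    finally show "(\<Sum>b\<in>Basis. blinfun_apply (blinfun_apply (G'' x) b) b) = c * F x" .
  qed
qed

section \<open>Closure properties of eigenfunctions\<close>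

lemma S3_laplace_eigen_add:
  assumes "S3_laplace_eigen F c" "S3_laplace_eigen Q c"
  shows "S3_laplace_eigen (F + Q) c"
proof -
  obtain D D2 E E2 where D: "hom_partials F D D2" "\<forall>x\<in>S3. (\<Sum>e\<in>Basis. D2 e x e) = c * F x"
    and E: "hom_partials Q E E2" "\<forall>x\<in>S3. (\<Sum>e\<in>Basis. E2 e x e) = c * Q x"
    using assms by (auto simp: S3_laplace_eigen_iff)
  have "hom_ext (F + Q) = (\<lambda>v. hom_ext F v + hom_ext Q v)" by (simp add: hom_ext_def fun_eq_iff)
  then have "hom_partials (F + Q) (\<lambda>v h. D v h + E v h) (\<lambda>e v h. D2 e v h + E2 e v h)"
    using D(1) E(1) unfolding hom_partials_def
    by (auto intro!: has_derivative_add continuous_on_add)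
  moreover have "\<forall>x\<in>S3. (\<Sum>e\<in>Basis. D2 e x e + E2 e x e) = c * (F + Q) x"
    using D E by (simp add: sum.distrib distrib_left)
  ultimately show ?thesis unfolding S3_laplace_eigen_iff by blast
qed

lemma S3_laplace_eigen_fscale:
  assumes "S3_laplace_eigen F c"
  shows "S3_laplace_eigen (fscale a F) c"
proof -
  obtain D D2 where D: "hom_partials F D D2" "\<forall>x\<in>S3. (\<Sum>e\<in>Basis. D2 e x e) = c * F x"
    using assms by (auto simp: S3_laplace_eigen_iff)
  have "hom_ext (fscale a F) = (\<lambda>v. a * hom_ext F v)" by (simp add: hom_ext_def fscale_def fun_eq_iff)
  then have "hom_partials (fscale a F) (\<lambda>v h. a * D v h) (\<lambda>e v h. a * D2 e v h)"
    using D(1) unfolding hom_partials_def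
    by (auto intro!: has_derivative_mult_right continuous_on_mult continuous_on_const)
  moreover have "\<forall>x\<in>S3. (\<Sum>e\<in>Basis. a * D2 e x e) = c * fscale a F x"
    using D by (simp add: fscale_def flip: sum_distrib_left)
  ultimately show ?thesis unfolding S3_laplace_eigen_iff by blast
qed

lemma S3_laplace_eigen_zero: "S3_laplace_eigen 0 c"
proof -
  have "hom_ext 0 = (\<lambda>v. 0)" by (simp add: hom_ext_def fun_eq_iff)
  then have "hom_partials 0 (\<lambda>v h. 0) (\<lambda>e v h. 0)"
    unfolding hom_partials_def by auto
  then show ?thesis unfolding S3_laplace_eigen_iff by fastforce
qed

text \<open>Bridges Green's identity, which is bilinear, and the inner product, which conjugates its
  second argument.\<close>

lemma S3_laplace_eigen_cnj:
  assumes "S3_laplace_eigen F c"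
  shows "S3_laplace_eigen (\<lambda>v. cnj (F v)) (cnj c)"
proof -
  obtain D D2 where D: "hom_partials F D D2" "\<forall>x\<in>S3. (\<Sum>e\<in>Basis. D2 e x e) = c * F x"
    using assms by (auto simp: S3_laplace_eigen_iff)
  have "hom_ext (\<lambda>v. cnj (F v)) = (\<lambda>v. cnj (hom_ext F v))" by (simp add: hom_ext_def fun_eq_iff)
  then have "hom_partials (\<lambda>v. cnj (F v)) (\<lambda>v h. cnj (D v h)) (\<lambda>e v h. cnj (D2 e v h))"
    using D(1) unfolding hom_partials_def
    by (auto intro!: has_derivative_cnj continuous_on_cnj)
  moreover have "\<forall>x\<in>S3. (\<Sum>e\<in>Basis. cnj (D2 e x e)) = cnj c * cnj (F x)"
    using D by (simp flip: cnj_sum)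
  ultimately show ?thesis unfolding S3_laplace_eigen_iff by blast
qed

text \<open>Stated for every exponent since differentiation stays in the family, n becoming n + 2;
  two derivatives of |v|^(-l) need nothing else.\<close>

lemma has_derivative_inverse_norm_power:
  fixes v :: "'a::real_inner"
  assumes "v \<noteq> 0"
  shows "((\<lambda>v. inverse (norm v) ^ n) has_derivative
          (\<lambda>h. - (of_nat n * inverse (norm v) ^ (n + 2) * (v \<bullet> h)))) (at v)"
proof -
  have 1: "(norm has_derivative (\<lambda>h. (v \<bullet> h) / norm v)) (at v)"
    using has_derivative_norm[OF assms]
    by (rule has_derivative_eq_rhs) (simp add: sgn_div_norm inner_commute divide_inverse fun_eq_iff)
  show ?thesis
    by (rule has_derivative_eq_rhs[OF has_derivative_power[OF Deriv.has_derivative_inverse[OF _ 1]]])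
       (use assms in \<open>cases n; auto simp: fun_eq_iff field_simps power2_eq_square\<close>)+
qed

text \<open>The degree-0 extension is |v|^(-l) u. On the sphere the product rule and Euler's
  identity turn its Laplacian into 0 - 2 l^2 u - 4 l u + l (l + 2) u = - l (l + 2) u, where 4 is the
  real dimension.\<close>

lemma S3_laplace_eigen_homogeneous_harmonic:
  fixes u :: "pt \<Rightarrow> complex"
  assumes u: "\<And>v. (u has_derivative Du v) (at v)"
    and Du: "\<And>v e. ((\<lambda>v. Du v e) has_derivative D2u e v) (at v)"
    and cont: "\<And>e g. continuous_on UNIV (\<lambda>v. D2u e v g)"
    and hom: "\<And>t v. u (t *\<^sub>R v) = of_real (t ^ l) * u v"
    and Euler: "\<And>v. Du v v = of_nat l * u v"
    and harm: "\<And>v. (\<Sum>e\<in>Basis. D2u e v e) = 0"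
  shows "S3_laplace_eigen (restrS3 u) (- of_nat (l * (l + 2)))"
proof -
  define \<rho> :: "nat \<Rightarrow> pt \<Rightarrow> real" where "\<rho> n v = inverse (norm v) ^ n" for n v
  have \<rho>: "(\<rho> n has_derivative (\<lambda>h. - (of_nat n * \<rho> (n + 2) v * (v \<bullet> h)))) (at v)" if "v \<noteq> 0" for n v
    unfolding \<rho>_def[abs_def] by (rule has_derivative_inverse_norm_power[OF that])
  have [continuous_intros]: "continuous_on (- {0}) (\<rho> n)" for n
    using \<rho> has_derivative_continuous by (intro continuous_at_imp_continuous_on) fastforce
  have [continuous_intros]: "continuous_on S u" "continuous_on S (\<lambda>v. Du v e)" for S e
    by (intro continuous_at_imp_continuous_on ballI has_derivative_continuous[OF u]
         has_derivative_continuous[OF Du])+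
  have [continuous_intros]: "continuous_on S (\<lambda>v. D2u e v g)" for S e g
    using cont continuous_on_subset by blast
  define D where "D v h = \<rho> l v *\<^sub>R Du v h - (of_nat l * \<rho> (l + 2) v * (v \<bullet> h)) *\<^sub>R u v" for v h
  define D2 where "D2 e v h = \<rho> l v *\<^sub>R D2u e v h - (of_nat l * \<rho> (l + 2) v * (v \<bullet> h)) *\<^sub>R Du v e
      - (of_nat l * \<rho> (l + 2) v * (v \<bullet> e)) *\<^sub>R Du v h
      - (of_nat l * \<rho> (l + 2) v * (h \<bullet> e)) *\<^sub>R u v
      + (of_nat l * of_nat (l + 2) * \<rho> (l + 4) v * (v \<bullet> h) * (v \<bullet> e)) *\<^sub>R u v" for e v h
  have ext: "hom_ext (restrS3 u) v = \<rho> l v *\<^sub>R u v" if "v \<noteq> 0" for v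
  proof -
    have "inverse (norm v) *\<^sub>R v \<in> S3" using that by (simp add: S3_def)
    then show ?thesis by (simp add: hom_ext_def restrS3_def hom \<rho>_def scaleR_conv_of_real)
  qed
  have "hom_partials (restrS3 u) D D2"
    unfolding hom_partials_def
  proof (intro conjI allI impI ballI)
    fix v :: pt assume v: "v \<noteq> 0"
    have "((\<lambda>v. \<rho> l v *\<^sub>R u v) has_derivative D v) (at v)"
      by (rule has_derivative_eq_rhs, (rule derivative_intros \<rho>[OF v] u)+)
         (auto simp: D_def fun_eq_iff algebra_simps)
    then show "(hom_ext (restrS3 u) has_derivative D v) (at v)"
      by (rule has_derivative_transform_within_open[where s = "- {0}"]) (use v ext in auto)
  next
    fix e v :: pt assume v: "v \<noteq> 0"
    show "((\<lambda>v. D v e) has_derivative D2 e v) (at v)"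
      unfolding D_def
      by (rule has_derivative_eq_rhs, (rule derivative_intros \<rho>[OF v] u Du)+)
         (auto simp: D2_def fun_eq_iff algebra_simps numeral_eq_Suc)
  next
    fix e g :: pt
    show "continuous_on (- {0}) (\<lambda>v. D2 e v g)"
      unfolding D2_def by (intro continuous_intros)
  qed
  moreover have "(\<Sum>e\<in>Basis. D2 e x e) = - of_nat (l * (l + 2)) * restrS3 u x" if x: "x \<in> S3" for x
  proof -
    have [simp]: "\<rho> n x = 1" for n using x by (simp add: \<rho>_def S3_def)
    have "linear (Du x)" using u has_derivative_linear by blast
    then have E: "(\<Sum>e\<in>Basis. (x \<bullet> e) *\<^sub>R Du x e) = of_nat l * u x"
      using linear_eq_sum_Basis[of "Du x" x] Euler by simp
    have N: "(\<Sum>e\<in>Basis. (x \<bullet> e) * (x \<bullet> e)) = 1"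
      using x euclidean_inner[of x x] by (simp add: S3_def norm_eq_sqrt_inner)
    have dim: "(\<Sum>e\<in>(Basis::pt set). e \<bullet> e) = 4"
      by (simp add: inner_Basis)
    have "(\<Sum>e\<in>Basis. D2 e x e)
       = (\<Sum>e\<in>Basis. D2u e x e) - (2 * of_nat l) * (\<Sum>e\<in>Basis. (x \<bullet> e) *\<^sub>R Du x e)
         - (of_nat l * (\<Sum>e\<in>(Basis::pt set). e \<bullet> e)) *\<^sub>R u x
         + (of_nat l * of_nat (l + 2) * (\<Sum>e\<in>Basis. (x \<bullet> e) * (x \<bullet> e))) *\<^sub>R u x"
      unfolding sum_distrib_left scaleR_sum_left sum.distrib[symmetric] sum_subtractf[symmetric]
      by (intro sum.cong refl) (simp add: D2_def scaleR_conv_of_real algebra_simps)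
    also have "\<dots> = - of_nat (l * (l + 2)) * u x"
      unfolding E N dim harm by (simp add: scaleR_conv_of_real algebra_simps)
    finally show ?thesis using x by (simp add: restrS3_def)
  qed
  ultimately show ?thesis unfolding S3_laplace_eigen_iff by blast
qed

section \<open>Orthogonality of eigenfunctions\<close>

lemma integrable_lborel_compact_support:
  fixes f :: "'a::euclidean_space \<Rightarrow> 'b::{banach, second_countable_topology}"
  assumes "continuous_on UNIV f" "\<And>v. norm v > R \<Longrightarrow> f v = 0"
  shows "integrable lborel f"
proof -
  have "(\<lambda>v. indicator (cball 0 R) v *\<^sub>R f v) = f"
    using assms(2) by (auto simp: fun_eq_iff indicator_def not_le)
  moreover have "integrable lborel (\<lambda>v. indicator (cball 0 R) v *\<^sub>R f v)"
    by (rule borel_integrable_compact) (auto intro: continuous_on_subset[OF assms(1)])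
  ultimately show ?thesis by simp
qed

text \<open>Translation invariance makes the integral of every difference quotient vanish.\<close>
lemma integral_directional_derivative_eq_0:
  fixes u :: "'a::euclidean_space \<Rightarrow> 'b::{banach, second_countable_topology}"
  assumes u: "\<And>v. (u has_derivative Du v) (at v)"
    and cont: "continuous_on UNIV (\<lambda>v. Du v e)"
    and supp: "\<And>v. norm v > R \<Longrightarrow> u v = 0"
  shows "(LINT v|lborel. Du v e) = 0"
proof -
  have contu: "continuous_on UNIV u"
    by (intro continuous_at_imp_continuous_on ballI has_derivative_continuous[OF u])
  have Du0: "Du v e = 0" if "norm v > R" for v
  proof -
    have "open {v::'a. norm v > R}" by (intro open_Collect_less continuous_intros)
    then have "(u has_derivative (\<lambda>h. 0)) (at v)"
      by (intro has_derivative_transform_within_open[of "\<lambda>v. 0" "\<lambda>h. 0" v UNIV "{v. norm v > R}" u])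
         (use that supp in auto)
    then show ?thesis using has_derivative_unique[OF u] by metis
  qed
  obtain M where M: "\<And>v. norm (Du v e) \<le> M"
  proof -
    have "compact ((\<lambda>v. Du v e) ` cball 0 R)"
      by (intro compact_continuous_image continuous_on_subset[OF cont]) auto
    then have "bounded ((\<lambda>v. Du v e) ` cball 0 R)" by (rule compact_imp_bounded)
    then obtain K where K: "\<forall>v\<in>cball 0 R. norm (Du v e) \<le> K"
      by (auto simp: bounded_iff)
    \<comment> \<open>The maximum with 0 covers the points outside the ball, where the derivative
      vanishes.\<close>
    have "norm (Du v e) \<le> max K 0" for v
      using K Du0[of v] by (cases "norm v \<le> R") (auto simp: le_max_iff_disj not_le)
    then show ?thesis by (rule that)
  qed
  define q where "q n v = of_nat (Suc n) *\<^sub>R (u (inverse (of_nat (Suc n)) *\<^sub>R e + v) - u v)" for n v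
  \<comment> \<open>A common majorant of the difference quotients: inside, the mean value inequality
    gives M; outside, both v and its shift by at most \<open>norm e\<close> lie off the
    support.\<close>
  define w where "w v = indicator (cball (0::'a) (R + norm e)) v * M" for v
  have line: "((\<lambda>t. u (t *\<^sub>R e + v)) has_vector_derivative Du (t *\<^sub>R e + v) e) (at t within S)" for t v S
  proof -
    have "((\<lambda>t. u (t *\<^sub>R e + v)) has_derivative (\<lambda>s. Du (t *\<^sub>R e + v) (s *\<^sub>R e))) (at t within S)"
      by (rule has_derivative_compose[OF _ u]) (auto intro!: derivative_eq_intros)
    moreover have "Du (t *\<^sub>R e + v) (s *\<^sub>R e) = s *\<^sub>R Du (t *\<^sub>R e + v) e" for s
      using u has_derivative_linear linear_scale by blast
    ultimately show ?thesis by (simp add: has_vector_derivative_def)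
  qed
  have bound: "norm (q n v) \<le> w v" for n v
  proof -
    define t :: real where "t = inverse (of_nat (Suc n))"
    have t: "0 < t" "t \<le> 1" by (auto simp: t_def field_simps)
    have "norm (u (t *\<^sub>R e + v) - u (0 *\<^sub>R e + v)) \<le> M * norm (t - 0)"
    proof (rule differentiable_bound[where S = "{0..t}" and f' = "\<lambda>s y. y *\<^sub>R Du (s *\<^sub>R e + v) e"])
      show "onorm (\<lambda>y. y *\<^sub>R Du (s *\<^sub>R e + v) e) \<le> M" for s
        by (rule onorm_le) (use M in \<open>simp add: mult.commute[of M] mult_left_mono\<close>)
    qed (use t line[unfolded has_vector_derivative_def] in auto)
    moreover have "norm (q n v) = norm (u (t *\<^sub>R e + v) - u (0 *\<^sub>R e + v)) / t"
      by (simp add: q_def t_def divide_inverse mult.commute del: of_nat_Suc)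
    ultimately have "norm (q n v) \<le> M" using t by (simp add: pos_divide_le_eq)
    moreover have "q n v = 0" if "norm v > R + norm e"
    proof -
      have "norm (t *\<^sub>R e) \<le> norm e" using t by (simp add: mult_left_le_one_le)
      then have "norm (t *\<^sub>R e + v) > R"
        using that norm_triangle_ineq2[of v "- (t *\<^sub>R e)"] by (simp add: add.commute)
      moreover have "norm v > R" using that norm_ge_zero[of e] by linarith
      ultimately show ?thesis using supp by (simp add: q_def t_def)
    qed
    ultimately show ?thesis by (auto simp: w_def indicator_def)
  qed
  have lim: "(\<lambda>n. q n v) \<longlonglongrightarrow> Du v e" for v
  proof -
    have "((\<lambda>t. u (t *\<^sub>R e + v)) has_derivative (\<lambda>t. t *\<^sub>R Du v e)) (at 0)"
      using line[of v 0 UNIV] by (simp add: has_vector_derivative_def)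
    then have "((\<lambda>h. norm (u (h *\<^sub>R e + v) - u v - h *\<^sub>R Du v e) / norm h) \<longlongrightarrow> 0) (at 0)"
      by (simp add: has_derivative_at)
    moreover have "filterlim (\<lambda>n. inverse (of_nat (Suc n))) (at (0::real)) sequentially"
      using LIMSEQ_inverse_real_of_nat by (simp add: filterlim_at)
    ultimately have lim0: "(\<lambda>n. norm (u (inverse (of_nat (Suc n)) *\<^sub>R e + v) - u v
        - inverse (of_nat (Suc n)) *\<^sub>R Du v e) / norm (inverse (of_nat (Suc n)) :: real)) \<longlonglongrightarrow> 0"
      by (rule filterlim_compose)
    have "norm (u (inverse (of_nat (Suc n)) *\<^sub>R e + v) - u v
        - inverse (of_nat (Suc n)) *\<^sub>R Du v e) / norm (inverse (of_nat (Suc n)) :: real) = norm (q n v - Du v e)" for n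
    proof -
      have "q n v - Du v e = of_nat (Suc n) *\<^sub>R (u (inverse (of_nat (Suc n)) *\<^sub>R e + v) - u v
        - inverse (of_nat (Suc n)) *\<^sub>R Du v e)"
        by (simp add: q_def scaleR_diff_right del: of_nat_Suc)
      then show ?thesis by (simp add: divide_inverse mult.commute del: of_nat_Suc)
    qed
    then show ?thesis using lim0 by (simp add: LIM_zero_iff tendsto_norm_zero_iff)
  qed
  have "q n \<in> borel_measurable lborel" for n
  proof -
    have "continuous_on UNIV (q n)" unfolding q_def
      by (intro continuous_intros continuous_on_compose2[OF contu]) auto
    then show ?thesis using borel_measurable_continuous_onI by auto
  qed
  moreover have "(\<lambda>v. Du v e) \<in> borel_measurable lborel"
    using borel_measurable_continuous_onI[OF cont] by simp
  moreover have "integrable lborel w" unfolding w_def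
    by (intro integrable_mult_left integrable_real_indicator) (use emeasure_compact_finite[OF compact_cball] in auto)
  ultimately have "(\<lambda>n. LINT v|lborel. q n v) \<longlonglongrightarrow> (LINT v|lborel. Du v e)"
    using lim bound by (intro integral_dominated_convergence[where w = w]) auto
  moreover have "(LINT v|lborel. q n v) = 0" for n
  proof -
    define c where "c = inverse (of_nat (Suc n)) *\<^sub>R e"
    have i1: "integrable lborel u" using contu supp by (rule integrable_lborel_compact_support)
    have "(LINT v|lborel. u (c + v)) = (LINT v|distr lborel borel ((+) c). u v)"
      by (subst integral_distr) (auto intro: borel_measurable_continuous_onI contu)
    then have eq: "(LINT v|lborel. u (c + v)) = (LINT v|lborel. u v)" by (simp add: lborel_distr_plus)
    have "integrable (distr lborel borel ((+) c)) u" using i1 by (simp add: lborel_distr_plus)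
    then have "integrable lborel (\<lambda>v. u (c + v))"
      by (subst (asm) integrable_distr_eq) (auto intro: borel_measurable_continuous_onI contu)
    then show ?thesis
      unfolding q_def c_def[symmetric] using i1 eq by simp
  qed
  ultimately show ?thesis by (simp add: LIMSEQ_const_iff)
qed

section \<open>Derivatives of degree-0 homogeneous extensions\<close>

lemma hom_ext_scaleR: "s > 0 \<Longrightarrow> hom_ext F (s *\<^sub>R v) = hom_ext F v"
  by (simp add: hom_ext_def mult.commute[of _ s] flip: mult.assoc)

lemma hom_ext_S3: "x \<in> S3 \<Longrightarrow> hom_ext F x = F x"
  by (simp add: hom_ext_def S3_def)

context
  fixes F D D2
  assumes H: "hom_partials F D D2"
begin

lemma hom_partials_first: "v \<noteq> 0 \<Longrightarrow> (hom_ext F has_derivative D v) (at v)"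
  using H by (simp only: hom_partials_def) blast

lemma hom_partials_second: "v \<noteq> 0 \<Longrightarrow> e \<in> Basis \<Longrightarrow> ((\<lambda>v. D v e) has_derivative D2 e v) (at v)"
  using H by (simp only: hom_partials_def) blast

lemma hom_partials_linear: "v \<noteq> 0 \<Longrightarrow> linear (D v)"
  using hom_partials_first has_derivative_linear by blast

lemma hom_partials_continuous:
  "continuous_on (- {0}) (hom_ext F)"
  "e \<in> Basis \<Longrightarrow> continuous_on (- {0}) (\<lambda>v. D v e)"
  "e \<in> Basis \<Longrightarrow> g \<in> Basis \<Longrightarrow> continuous_on (- {0}) (\<lambda>v. D2 e v g)"
  subgoal by (intro continuous_at_imp_continuous_on ballI has_derivative_continuous[OF hom_partials_first]) auto
  subgoal by (intro continuous_at_imp_continuous_on ballI has_derivative_continuous[OF hom_partials_second]) auto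
  subgoal using H by (simp only: hom_partials_def)
  done

text \<open>The extension is constant along each ray, and the curve (1 + t) v stays on its ray for t
  > -1.\<close>

lemma hom_partials_radial:
  assumes "v \<noteq> 0"
  shows "D v v = 0"
proof -
  have "((\<lambda>t. hom_ext F ((1 + t) *\<^sub>R v)) has_derivative (\<lambda>t. D v (t *\<^sub>R v))) (at 0)"
    by (rule has_derivative_compose[where f = "\<lambda>t. (1 + t) *\<^sub>R v"])
       (auto intro!: derivative_eq_intros hom_partials_first assms)
  moreover have "((\<lambda>t. hom_ext F ((1 + t) *\<^sub>R v)) has_derivative (\<lambda>t. 0)) (at 0)"
    by (rule has_derivative_transform_within_open[of "\<lambda>t. hom_ext F v" _ _ _ "{-1<..}"])
       (auto simp: hom_ext_scaleR)
  ultimately have "(\<lambda>t. D v (t *\<^sub>R v)) = (\<lambda>t. 0)" by (rule has_derivative_unique)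
  from fun_cong[OF this, of 1] show ?thesis by simp
qed

text \<open>Each derivative lowers the degree of homogeneity by one: -1 here, and -2 for the second
  derivatives below.\<close>

lemma hom_partials_first_scale:
  assumes "v \<noteq> 0" "s > 0"
  shows "D (s *\<^sub>R v) h = inverse s *\<^sub>R D v h"
proof -
  have "s *\<^sub>R v \<noteq> 0" using assms by simp
  then have "((\<lambda>v. hom_ext F (s *\<^sub>R v)) has_derivative (\<lambda>h. D (s *\<^sub>R v) (s *\<^sub>R h))) (at v)"
    by (intro has_derivative_compose[OF _ hom_partials_first]) (auto intro!: derivative_eq_intros)
  then have "(hom_ext F has_derivative (\<lambda>h. D (s *\<^sub>R v) (s *\<^sub>R h))) (at v)"
    using assms by (simp add: hom_ext_scaleR)
  then have "D v h = D (s *\<^sub>R v) (s *\<^sub>R h)"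
    using has_derivative_unique[OF hom_partials_first[OF assms(1)]] by metis
  then show ?thesis
    using linear_scale[OF hom_partials_linear[OF \<open>s *\<^sub>R v \<noteq> 0\<close>]] assms by simp
qed

lemma hom_partials_second_scale:
  assumes "v \<noteq> 0" "s > 0" "e \<in> Basis"
  shows "D2 e (s *\<^sub>R v) h = inverse (s\<^sup>2) *\<^sub>R D2 e v h"
proof -
  have sv: "s *\<^sub>R v \<noteq> 0" using assms by simp
  then have "((\<lambda>v. D (s *\<^sub>R v) e) has_derivative (\<lambda>h. D2 e (s *\<^sub>R v) (s *\<^sub>R h))) (at v)"
    using assms by (intro has_derivative_compose[OF _ hom_partials_second]) (auto intro!: derivative_eq_intros)
  moreover have "((\<lambda>v. D (s *\<^sub>R v) e) has_derivative (\<lambda>h. inverse s *\<^sub>R D2 e v h)) (at v)"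
    by (rule has_derivative_transform_within_open[of "\<lambda>v. inverse s *\<^sub>R D v e" _ _ _ "- {0}"])
       (use assms hom_partials_first_scale in \<open>auto intro!: derivative_intros hom_partials_second\<close>)
  ultimately have "D2 e (s *\<^sub>R v) (s *\<^sub>R h) = inverse s *\<^sub>R D2 e v h"
    using has_derivative_unique by metis
  moreover have "D2 e (s *\<^sub>R v) (s *\<^sub>R h) = s *\<^sub>R D2 e (s *\<^sub>R v) h"
    using hom_partials_second[OF sv assms(3)] has_derivative_linear linear_scale by blast
  ultimately have "inverse s *\<^sub>R s *\<^sub>R D2 e (s *\<^sub>R v) h = inverse s *\<^sub>R inverse s *\<^sub>R D2 e v h" by simp
  then show ?thesis using assms by (simp add: power2_eq_square)
qed

text \<open>The eigenvalue equation is given only on the sphere; homogeneity of degree -2 spreads it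
  to every ray, at the price of the factor 1/|v|^2.\<close>

lemma hom_partials_laplace:
  assumes tr: "\<And>x. x \<in> S3 \<Longrightarrow> (\<Sum>e\<in>Basis. D2 e x e) = c * F x" and "v \<noteq> 0"
  shows "(\<Sum>e\<in>Basis. D2 e v e) = inverse (v \<bullet> v) *\<^sub>R (c * hom_ext F v)"
proof -
  define x where "x = inverse (norm v) *\<^sub>R v"
  have x: "x \<in> S3" "x \<noteq> 0" "v = norm v *\<^sub>R x" using assms by (auto simp: x_def S3_def)
  have "(\<Sum>e\<in>Basis. D2 e v e) = (\<Sum>e\<in>Basis. inverse ((norm v)\<^sup>2) *\<^sub>R D2 e x e)"
    using hom_partials_second_scale[OF x(2), of "norm v"] x(3) assms(2) by (intro sum.cong) auto
  also have "\<dots> = inverse ((norm v)\<^sup>2) *\<^sub>R (c * F x)" by (simp add: tr[OF x(1)] flip: scaleR_sum_right)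
  finally show ?thesis by (simp add: x_def hom_ext_def power2_norm_eq_inner)
qed

end

section \<open>A radial cutoff supported on 1 <= |v| <= 2\<close>

definition annulus_bump :: "pt \<Rightarrow> real" where
  "annulus_bump v = (max 0 ((v \<bullet> v - 1) * (4 - v \<bullet> v)))\<^sup>2"

text \<open>The factor 1/|v|^2 is the one that the Laplacian of a degree-0 extension carries off the
  sphere, so this is the weight for which Green's identity yields orthogonality.\<close>

definition annulus_weight :: "pt \<Rightarrow> real" where
  "annulus_weight v = annulus_bump v * inverse (v \<bullet> v)"

text \<open>Squaring smooths the corner of the positive part at 0, so the cutoff is continuously
  differentiable, which is the regularity the divergence argument uses.\<close>

lemma DERIV_square_max_0: "((\<lambda>x. (max 0 x)\<^sup>2) has_real_derivative 2 * max 0 x) (at x)"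
proof -
  consider "x < 0" | "x = 0" | "x > 0" by linarith
  then show ?thesis
  proof cases
    case 1
    have "((\<lambda>x. (max 0 x)\<^sup>2) has_real_derivative 0) (at x)"
      by (rule has_field_derivative_transform_within_open[of "\<lambda>x. 0" _ _ "{..<0}"]) (use 1 in auto)
    then show ?thesis using 1 by simp
  next
    case 2
    have "((\<lambda>h::real. max 0 h) \<longlongrightarrow> max 0 0) (at 0)" by (intro tendsto_intros)
    moreover have "(max 0 h)\<^sup>2 / h = max 0 h" for h :: real by (auto simp: max_def power2_eq_square)
    ultimately show ?thesis using 2 by (simp add: DERIV_def)
  next
    case 3
    have "((\<lambda>x. (max 0 x)\<^sup>2) has_real_derivative 2 * x) (at x)"
      by (rule has_field_derivative_transform_within_open[of "\<lambda>x. x\<^sup>2" _ _ "{0<..}"])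
         (use 3 in \<open>auto intro!: derivative_eq_intros\<close>)
    then show ?thesis using 3 by simp
  qed
qed

text \<open>The gradient of the cutoff is this number times v. With s = |v|^2 it is the chain rule
  for the square of the positive part of (s - 1)(4 - s), whose s-derivative is 5 - 2 s; the factor 4
  collects one 2 from the square and one from s.\<close>

definition annulus_bump_slope :: "pt \<Rightarrow> real" where
  "annulus_bump_slope v = 4 * max 0 ((v \<bullet> v - 1) * (4 - v \<bullet> v)) * (5 - 2 * (v \<bullet> v))"

lemma has_derivative_annulus_bump:
  "(annulus_bump has_derivative (\<lambda>h. annulus_bump_slope v * (v \<bullet> h))) (at v)"
proof -
  define P where "P v = (v \<bullet> v - 1) * (4 - v \<bullet> v)" for v :: pt
  have "(P has_derivative (\<lambda>h. 2 * (5 - 2 * (v \<bullet> v)) * (v \<bullet> h))) (at v)"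
    unfolding P_def[abs_def]
    by (rule has_derivative_eq_rhs, (rule derivative_intros)+)
       (auto simp: fun_eq_iff inner_commute algebra_simps)
  from has_derivative_compose[OF this DERIV_square_max_0[unfolded has_field_derivative_def]]
  have "((\<lambda>v. (max 0 (P v))\<^sup>2) has_derivative
      (\<lambda>h. 2 * max 0 (P v) * (2 * (5 - 2 * (v \<bullet> v)) * (v \<bullet> h)))) (at v)" .
  then show ?thesis
    unfolding annulus_bump_def[abs_def] annulus_bump_slope_def P_def
    by (rule has_derivative_eq_rhs) (auto simp: fun_eq_iff algebra_simps)
qed

lemma continuous_on_annulus_bump [continuous_intros]:
  "continuous_on S annulus_bump" "continuous_on S annulus_bump_slope"
  unfolding annulus_bump_def[abs_def] annulus_bump_slope_def[abs_def] by (intro continuous_intros)+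

lemma annulus_poly_nonpos: "norm v \<le> 1 \<or> norm v \<ge> 2 \<Longrightarrow> (v \<bullet> v - 1) * (4 - v \<bullet> v) \<le> 0"
proof (erule disjE)
  assume "norm v \<le> 1"
  then have "v \<bullet> v \<le> 1" by (simp add: norm_le_square)
  then show ?thesis by (simp add: mult_nonpos_nonneg)
next
  assume "norm v \<ge> 2"
  then have "v \<bullet> v \<ge> 4" using power_mono[of 2 "norm v" 2] by (simp add: power2_norm_eq_inner)
  then show ?thesis by (simp add: mult_nonneg_nonpos)
qed

lemma annulus_bump_eq_0:
  assumes "norm v \<le> 1 \<or> norm v \<ge> 2"
  shows "annulus_bump v = 0" "annulus_bump_slope v = 0"
  using annulus_poly_nonpos[OF assms] by (auto simp: annulus_bump_def annulus_bump_slope_def max_def)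

lemma continuous_on_extend_0:
  fixes g :: "'a::real_normed_vector \<Rightarrow> 'b::real_normed_vector"
  assumes "continuous_on (- {0}) g" "\<And>v. norm v < 1 \<Longrightarrow> g v = 0"
  shows "continuous_on UNIV g"
proof -
  have "continuous_on (ball 0 1) g"
    using assms(2) by (subst continuous_on_cong[OF refl, of _ _ "\<lambda>v. 0"]) auto
  then have "continuous_on (- {0} \<union> ball 0 1) g"
    using assms(1) by (intro continuous_on_open_Un) auto
  moreover have "- {0} \<union> ball 0 1 = (UNIV :: 'a set)" by auto
  ultimately show ?thesis by simp
qed

text \<open>Green's identity: the radial cutoff contributes nothing to the boundary terms because
  degree-0 homogeneous functions have vanishing radial derivative.\<close>
lemma integral_eigen_orthogonal:
  assumes "S3_laplace_eigen F c" "S3_laplace_eigen Q d" "c \<noteq> d"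
  shows "(LINT v|lborel. annulus_weight v *\<^sub>R (hom_ext F v * hom_ext Q v)) = 0"
proof -
  obtain A A2 where A: "hom_partials F A A2" and trA: "\<And>x. x \<in> S3 \<Longrightarrow> (\<Sum>e\<in>Basis. A2 e x e) = c * F x"
    using assms(1) unfolding S3_laplace_eigen_iff by blast
  obtain B B2 where B: "hom_partials Q B B2" and trB: "\<And>x. x \<in> S3 \<Longrightarrow> (\<Sum>e\<in>Basis. B2 e x e) = d * Q x"
    using assms(2) unfolding S3_laplace_eigen_iff by blast
  define f where "f = hom_ext F"
  define q where "q = hom_ext Q"
  \<comment> \<open>The components of the cutoff times q grad f - f grad q. In its divergence the
    products of first derivatives of f and q cancel.\<close>
  define X where "X e v = annulus_bump v *\<^sub>R (q v * A v e - f v * B v e)" for e v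
  define DX where "DX e v h =
      annulus_bump v *\<^sub>R (q v * A2 e v h + B v h * A v e - (f v * B2 e v h + A v h * B v e))
      + (annulus_bump_slope v * (v \<bullet> h)) *\<^sub>R (q v * A v e - f v * B v e)" for e v h
  have DX: "(X e has_derivative DX e v) (at v)" if e: "e \<in> Basis" for e v
  proof (cases "v = 0")
    case True
    \<comment> \<open>At the origin the extensions need not be differentiable, but the cutoff
      vanishes on the whole unit ball.\<close>
    have "(X e has_derivative (\<lambda>h. 0)) (at v)"
      by (rule has_derivative_transform_within_open[of "\<lambda>v. 0" _ _ _ "ball 0 1"])
         (use True in \<open>auto simp: X_def annulus_bump_eq_0\<close>)
    moreover have "DX e v = (\<lambda>h. 0)" using True by (simp add: DX_def annulus_bump_eq_0 fun_eq_iff)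
    ultimately show ?thesis by simp
  next
    case False
    note [derivative_intros] = hom_partials_first[OF A False, folded f_def] hom_partials_first[OF B False, folded q_def]
       hom_partials_second[OF A False e] hom_partials_second[OF B False e] has_derivative_annulus_bump
    show ?thesis unfolding X_def
      by (rule has_derivative_eq_rhs, (rule derivative_intros)+)
         (auto simp: DX_def fun_eq_iff algebra_simps)
  qed
  note [continuous_intros] = hom_partials_continuous[OF A, folded f_def] hom_partials_continuous[OF B, folded q_def]
  have cont: "continuous_on UNIV (\<lambda>v. DX e v e)" if e: "e \<in> Basis" for e
    by (rule continuous_on_extend_0)
       (use e in \<open>auto simp: DX_def annulus_bump_eq_0 intro!: continuous_intros\<close>)
  have supp: "X e v = 0" "DX e v e = 0" if "norm v > 2" for e v
    using that by (simp_all add: X_def DX_def annulus_bump_eq_0)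
  have "(\<Sum>e\<in>Basis. (LINT v|lborel. DX e v e)) = 0"
    using integral_directional_derivative_eq_0[OF DX cont supp(1)] by simp
  moreover have "(\<Sum>e\<in>Basis. (LINT v|lborel. DX e v e)) = (LINT v|lborel. (\<Sum>e\<in>Basis. DX e v e))"
    by (intro Bochner_Integration.integral_sum[symmetric] integrable_lborel_compact_support[OF cont supp(2)])
  \<comment> \<open>The gradient of the cutoff is radial and meets only radial derivatives, which
    are 0. What remains is the cutoff times q Lap f - f Lap q, hence the factor c - d.\<close>
  moreover have "(\<Sum>e\<in>Basis. DX e v e) = (c - d) * (annulus_weight v *\<^sub>R (f v * q v))" for v
  proof (cases "v = 0")
    case True
    then show ?thesis by (simp add: DX_def annulus_bump_eq_0 annulus_weight_def)
  next
    case False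
    have "(\<Sum>e\<in>Basis. DX e v e) = annulus_bump v *\<^sub>R (q v * (\<Sum>e\<in>Basis. A2 e v e) - f v * (\<Sum>e\<in>Basis. B2 e v e))
        + annulus_bump_slope v *\<^sub>R (q v * (\<Sum>e\<in>Basis. (v \<bullet> e) *\<^sub>R A v e) - f v * (\<Sum>e\<in>Basis. (v \<bullet> e) *\<^sub>R B v e))"
      unfolding sum_distrib_left sum_subtractf[symmetric] scaleR_sum_right sum.distrib[symmetric]
      by (intro sum.cong refl) (simp add: DX_def algebra_simps)
    also have "(\<Sum>e\<in>Basis. (v \<bullet> e) *\<^sub>R A v e) = 0"
      using linear_eq_sum_Basis[OF hom_partials_linear[OF A False], of v] hom_partials_radial[OF A False] by simp
    also have "(\<Sum>e\<in>Basis. (v \<bullet> e) *\<^sub>R B v e) = 0"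
      using linear_eq_sum_Basis[OF hom_partials_linear[OF B False], of v] hom_partials_radial[OF B False] by simp
    also have "(\<Sum>e\<in>Basis. A2 e v e) = inverse (v \<bullet> v) *\<^sub>R (c * f v)"
      unfolding f_def by (rule hom_partials_laplace[OF A trA False])
    also have "(\<Sum>e\<in>Basis. B2 e v e) = inverse (v \<bullet> v) *\<^sub>R (d * q v)"
      unfolding q_def by (rule hom_partials_laplace[OF B trB False])
    finally show ?thesis by (simp add: annulus_weight_def algebra_simps)
  qed
  ultimately have "(LINT v|lborel. (c - d) * (annulus_weight v *\<^sub>R (f v * q v))) = 0" by simp
  then show ?thesis using assms(3)
    unfolding integral_mult_right_zero by (simp add: f_def q_def)
qed

section \<open>Density of the siblings\<close>

interpretation fs: vector_space fscale
  by unfold_locales (auto simp: fscale_def fun_eq_iff algebra_simps)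

lemma S3_iff: "v \<in> S3 \<longleftrightarrow> fst v * cnj (fst v) + snd v * cnj (snd v) = 1"
proof -
  have "fst v * cnj (fst v) + snd v * cnj (snd v) = complex_of_real ((norm v)\<^sup>2)"
    by (simp add: norm_prod_def flip: complex_norm_square)
  also have "\<dots> = 1 \<longleftrightarrow> (norm v)\<^sup>2 = 1" by (metis of_real_1 of_real_eq_iff)
  finally show ?thesis using norm_ge_zero[of v] by (auto simp: S3_def power2_eq_1_iff)
qed

lemma continuous_on_restrS3: "continuous_on S3 (restrS3 F) \<longleftrightarrow> continuous_on S3 F"
  by (rule continuous_on_cong) (auto simp: restrS3_def)

lemma S3_laplace_eigen_sib: "S3_laplace_eigen (restrS3 (sib a b j)) (- of_nat ((a + b) * (a + b + 2)))"
  by (rule S3_laplace_eigen_homogeneous_harmonic[OF has_derivative_sib has_derivative_dsib continuous_on_d2sib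
        sib_scaleR dsib_Euler d2sib_trace])

definition sib_span :: "(pt \<Rightarrow> complex) set" where
  "sib_span = fs.span {restrS3 (sib a b j) | a b j. True}"

lemma subspace_sib_span: "fs.subspace sib_span"
  unfolding sib_span_def by (rule fs.subspace_span)

lemma sib_span_base: "restrS3 (sib a b j) \<in> sib_span"
  unfolding sib_span_def by (rule fs.span_base) blast

lemma sib_lag_span: "restrS3 (sib_lag a b j) \<in> sib_span"
proof (cases j)
  case 0
  then have "restrS3 (sib_lag a b j) = 0" by (simp add: restrS3_def fun_eq_iff)
  then show ?thesis using fs.subspace_0[OF subspace_sib_span] by simp
next
  case (Suc i)
  then have "restrS3 (sib_lag a b j) = restrS3 (sib a b i)" by (simp add: restrS3_def fun_eq_iff)
  then show ?thesis using sib_span_base by simp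
qed

lemma sib_partition:
  assumes "v \<in> S3"
  shows "cnj (fst v) * sib (Suc a) b j v + cnj (snd v) * sib a (Suc b) j v = sib a b j v"
proof -
  have "cnj (fst v) * sib (Suc a) b j v + cnj (snd v) * sib a (Suc b) j v
      = (fst v * cnj (fst v) + snd v * cnj (snd v)) * sib a b j v"
    by (simp add: sib_Suc_left sib_Suc_right algebra_simps)
  then show ?thesis using assms by (simp add: S3_iff)
qed

text \<open>Eliminates cnj alpha times \<open>sib (Suc a) (b - 1) j\<close> between
  \<open>Suc_sib_Suc\<close> at (a + 1, b) and \<open>sib_partition\<close> at (a, b - 1). The
  coefficients (a + 1) and b add up to a + b + 1, which is never 0 and can be divided out. The
  result has degrees one below and one above.\<close>

lemma cnj_snd_mult_sib:
  assumes "v \<in> S3"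
  shows "of_nat (a + b + 1) * (cnj (snd v) * sib a b j v)
       = of_nat b * sib a (b - 1) j v - of_nat (Suc j) * sib (Suc a) b (Suc j) v"
proof (cases b)
  case 0
  show ?thesis unfolding Suc_sib_Suc by (simp add: 0 algebra_simps)
next
  case (Suc b')
  show ?thesis unfolding Suc_sib_Suc using sib_partition[OF assms, of a b' j, symmetric]
    by (simp add: Suc algebra_simps)
qed

lemma cnj_fst_mult_sib:
  assumes "v \<in> S3"
  shows "of_nat (a + b + 1) * (cnj (fst v) * sib a b j v)
       = of_nat a * sib (a - 1) b j v + of_nat (Suc j) * sib a (Suc b) (Suc j) v"
proof (cases a)
  case 0
  show ?thesis unfolding Suc_sib_Suc by (simp add: 0 algebra_simps)
next
  case (Suc a')
  show ?thesis unfolding Suc_sib_Suc using sib_partition[OF assms, of a' b j, symmetric]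
    by (simp add: Suc algebra_simps)
qed

lemma sib_span_cnj_base:
  "restrS3 (\<lambda>v. cnj (fst v) * sib a b j v) \<in> sib_span"
  "restrS3 (\<lambda>v. cnj (snd v) * sib a b j v) \<in> sib_span"
proof -
  define c :: complex where "c = inverse (of_nat (a + b + 1))"
  have c: "z = c * w" if "of_nat (a + b + 1) * z = w" for z w
  proof -
    have "of_nat (a + b + 1) \<noteq> (0::complex)" by (simp only: of_nat_eq_0_iff)
    then show ?thesis using that by (auto simp: c_def)
  qed
  have "restrS3 (\<lambda>v. cnj (fst v) * sib a b j v)
      = fscale (c * of_nat a) (restrS3 (sib (a - 1) b j)) + fscale (c * of_nat (Suc j)) (restrS3 (sib a (Suc b) (Suc j)))"
    using c[OF cnj_fst_mult_sib] by (auto simp: fun_eq_iff restrS3_def fscale_def algebra_simps)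
  then show "restrS3 (\<lambda>v. cnj (fst v) * sib a b j v) \<in> sib_span"
    by (simp add: fs.subspace_add fs.subspace_scale subspace_sib_span sib_span_base)
  have "restrS3 (\<lambda>v. cnj (snd v) * sib a b j v)
      = fscale (c * of_nat b) (restrS3 (sib a (b - 1) j)) - fscale (c * of_nat (Suc j)) (restrS3 (sib (Suc a) b (Suc j)))"
    using c[OF cnj_snd_mult_sib] by (auto simp: fun_eq_iff restrS3_def fscale_def algebra_simps)
  then show "restrS3 (\<lambda>v. cnj (snd v) * sib a b j v) \<in> sib_span"
    by (simp add: fs.subspace_diff fs.subspace_scale subspace_sib_span sib_span_base)
qed

lemma sib_span_mult_induct:
  assumes "\<And>a b j. restrS3 (\<lambda>v. g v * sib a b j v) \<in> sib_span" "F \<in> sib_span"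
  shows "(\<lambda>v. g v * F v) \<in> sib_span"
  using assms(2) unfolding sib_span_def
proof (induction rule: fs.span_induct_alt)
  case base
  then show ?case using fs.span_zero by (simp add: zero_fun_def)
next
  case (step c x y)
  then obtain a b j where x: "x = restrS3 (sib a b j)" by blast
  have "(\<lambda>v. g v * (fscale c x + y) v) = fscale c (restrS3 (\<lambda>v. g v * sib a b j v)) + (\<lambda>v. g v * y v)"
    by (auto simp: x fun_eq_iff fscale_def restrS3_def algebra_simps)
  then show ?case using assms(1)[of a b j] step by (simp add: sib_span_def fs.span_add fs.span_scale)
qed

text \<open>The conjugate coordinates come first because the others reduce to them: alpha times a
  sibling is a sibling of higher degree plus cnj beta times a lagged one, and similarly for
  beta.\<close>

lemma sib_span_coordinate_mult:
  assumes "F \<in> sib_span"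
  shows "(\<lambda>v. fst v * F v) \<in> sib_span" "(\<lambda>v. cnj (fst v) * F v) \<in> sib_span"
    "(\<lambda>v. snd v * F v) \<in> sib_span" "(\<lambda>v. cnj (snd v) * F v) \<in> sib_span"
proof -
  have cf: "(\<lambda>v. cnj (fst v) * F v) \<in> sib_span" and cs: "(\<lambda>v. cnj (snd v) * F v) \<in> sib_span" if "F \<in> sib_span" for F
    using that by (intro sib_span_mult_induct sib_span_cnj_base; assumption)+
  show "(\<lambda>v. cnj (fst v) * F v) \<in> sib_span" "(\<lambda>v. cnj (snd v) * F v) \<in> sib_span"
    using cf cs assms by blast+
  show "(\<lambda>v. fst v * F v) \<in> sib_span"
  proof (rule sib_span_mult_induct[OF _ assms])
    fix a b j
    have "restrS3 (\<lambda>v. fst v * sib a b j v) = restrS3 (sib (Suc a) b j) + (\<lambda>v. cnj (snd v) * restrS3 (sib_lag a b j) v)"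
      by (auto simp: fun_eq_iff restrS3_def sib_Suc_left)
    then show "restrS3 (\<lambda>v. fst v * sib a b j v) \<in> sib_span"
      by (simp add: fs.subspace_add subspace_sib_span sib_span_base cs sib_lag_span)
  qed
  show "(\<lambda>v. snd v * F v) \<in> sib_span"
  proof (rule sib_span_mult_induct[OF _ assms])
    fix a b j
    have "restrS3 (\<lambda>v. snd v * sib a b j v) = restrS3 (sib a (Suc b) j) - (\<lambda>v. cnj (fst v) * restrS3 (sib_lag a b j) v)"
      by (auto simp: fun_eq_iff restrS3_def sib_Suc_right)
    then show "restrS3 (\<lambda>v. snd v * sib a b j v) \<in> sib_span"
      by (simp add: fs.subspace_diff subspace_sib_span sib_span_base cf sib_lag_span)
  qed
qed

lemma sib_span_linear_mult:
  assumes "F \<in> sib_span"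
  shows "(\<lambda>v. (a * fst v + b * cnj (fst v) + c * snd v + d * cnj (snd v)) * F v) \<in> sib_span"
proof -
  have "(\<lambda>v. (a * fst v + b * cnj (fst v) + c * snd v + d * cnj (snd v)) * F v)
     = fscale a (\<lambda>v. fst v * F v) + fscale b (\<lambda>v. cnj (fst v) * F v)
       + fscale c (\<lambda>v. snd v * F v) + fscale d (\<lambda>v. cnj (snd v) * F v)"
    by (auto simp: fun_eq_iff fscale_def algebra_simps)
  then show ?thesis using sib_span_coordinate_mult[OF assms]
    by (simp add: fs.subspace_add fs.subspace_scale subspace_sib_span)
qed

text \<open>Formulated as stability under multiplication, with F arbitrary, so that the product case
  of the induction is composition of two multiplications.\<close>

lemma sib_span_real_polynomial_mult:
  assumes "real_polynomial_function g" "F \<in> sib_span"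
  shows "(\<lambda>v. complex_of_real (g v) * F v) \<in> sib_span"
  using assms
proof (induction arbitrary: F)
  case (linear f)
  have lf: "linear f" using linear(1) by (rule bounded_linear.linear)
  have rep: "complex_of_real (f v) = of_real (Re (fst v)) * of_real (f (1, 0)) + of_real (Im (fst v)) * of_real (f (\<i>, 0))
     + of_real (Re (snd v)) * of_real (f (0, 1)) + of_real (Im (snd v)) * of_real (f (0, \<i>))" for v
    using linear_eq_sum_Basis[OF lf, of v]
    by (cases v) (simp add: sum_Basis_pt inner_prod_def inner_complex_def)
  have re: "complex_of_real (Re z) = (z + cnj z) / 2" for z by (simp add: complex_add_cnj)
  have im: "complex_of_real (Im z) = - (\<i> / 2) * (z - cnj z)" for z by (simp add: complex_eq_iff)
  define p q r s where "p = complex_of_real (f (1, 0))" and "q = complex_of_real (f (\<i>, 0))"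
    and "r = complex_of_real (f (0, 1))" and "s = complex_of_real (f (0, \<i>))"
  \<comment> \<open>A real linear form rewritten in the coordinates and their conjugates.\<close>
  have "complex_of_real (f v) = (p - \<i> * q) / 2 * fst v + (p + \<i> * q) / 2 * cnj (fst v)
      + (r - \<i> * s) / 2 * snd v + (r + \<i> * s) / 2 * cnj (snd v)" for v
    unfolding rep[of v] re im p_def[symmetric] q_def[symmetric] r_def[symmetric] s_def[symmetric]
    by (simp add: field_simps)
  then show ?case using sib_span_linear_mult[OF linear(2)] by (simp only:)
next
  case (const c)
  have "(\<lambda>v. complex_of_real c * F v) = fscale (of_real c) F" by (simp add: fscale_def)
  then show ?case using const by (simp add: fs.subspace_scale subspace_sib_span)
next
  case (add f g)
  have "(\<lambda>v. complex_of_real (f v + g v) * F v) = (\<lambda>v. complex_of_real (f v) * F v) + (\<lambda>v. complex_of_real (g v) * F v)"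
    by (simp add: fun_eq_iff algebra_simps)
  then show ?case using add by (simp add: fs.subspace_add subspace_sib_span)
next
  case (mult f g)
  have "(\<lambda>v. complex_of_real (f v * g v) * F v) = (\<lambda>v. complex_of_real (f v) * (complex_of_real (g v) * F v))"
    by (simp add: fun_eq_iff algebra_simps)
  then show ?case using mult by simp
qed

lemma polynomial_function_sib_span:
  fixes g :: "pt \<Rightarrow> complex"
  assumes "polynomial_function g"
  shows "restrS3 g \<in> sib_span"
proof -
  have 1: "real_polynomial_function (\<lambda>v. Re (g v))" "real_polynomial_function (\<lambda>v. Im (g v))"
    using assms bounded_linear_Re bounded_linear_Im unfolding polynomial_function_def o_def by blast+
  \<comment> \<open>The constant 1 is \<open>sib 0 0 0\<close>; multiplying it by the real and
    imaginary parts produces g on the sphere.\<close>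
  have "restrS3 g = (\<lambda>v. complex_of_real (Re (g v)) * restrS3 (sib 0 0 0) v)
      + fscale \<i> (\<lambda>v. complex_of_real (Im (g v)) * restrS3 (sib 0 0 0) v)"
    by (auto simp: fun_eq_iff restrS3_def fscale_def sib_0_0 complex_eq_iff)
  then show ?thesis using 1[THEN sib_span_real_polynomial_mult, OF sib_span_base]
    by (simp add: fs.subspace_add fs.subspace_scale subspace_sib_span)
qed

section \<open>Completeness\<close>

lemma continuous_on_hom_ext:
  assumes "continuous_on S3 F"
  shows "continuous_on (- {0}) (hom_ext F)"
  unfolding hom_ext_def
proof (rule continuous_on_compose2[OF assms])
  show "(\<lambda>v. inverse (norm v) *\<^sub>R v) ` (- {0}) \<subseteq> S3"
    by (rule image_subsetI) (simp add: S3_def)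
qed (auto intro!: continuous_intros)

lemma continuous_on_weighted_hom_ext:
  assumes "continuous_on S3 F"
  shows "continuous_on UNIV (\<lambda>v. annulus_weight v *\<^sub>R hom_ext F v)"
proof (rule continuous_on_extend_0)
  have "\<forall>v\<in>- {0::pt}. v \<bullet> v \<noteq> 0" by simp
  then show "continuous_on (- {0}) (\<lambda>v. annulus_weight v *\<^sub>R hom_ext F v)"
    unfolding annulus_weight_def by (intro continuous_intros continuous_on_hom_ext assms)
qed (simp add: annulus_weight_def annulus_bump_eq_0)

text \<open>In polar coordinates the radial weight splits off, so this is a positive constant times
  the surface integral.\<close>

definition S3_int :: "(pt \<Rightarrow> complex) \<Rightarrow> complex" where
  "S3_int F = (LINT v|lborel. annulus_weight v *\<^sub>R hom_ext F v)"

lemma integrable_weighted_hom_ext: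
  assumes "continuous_on S3 F"
  shows "integrable lborel (\<lambda>v. annulus_weight v *\<^sub>R hom_ext F v)"
  by (rule integrable_lborel_compact_support[OF continuous_on_weighted_hom_ext[OF assms], where R = 2])
     (simp add: annulus_weight_def annulus_bump_eq_0)

lemma S3_int_add:
  assumes "continuous_on S3 F" "continuous_on S3 Q"
  shows "S3_int (\<lambda>x. F x + Q x) = S3_int F + S3_int Q"
  using Bochner_Integration.integral_add[OF assms[THEN integrable_weighted_hom_ext]]
  by (simp add: S3_int_def hom_ext_def algebra_simps)

lemma S3_int_cmult: "S3_int (\<lambda>x. c * F x) = c * S3_int F"
  unfolding S3_int_def integral_mult_right_zero[symmetric] by (simp add: hom_ext_def)

lemma annulus_weight_nonneg: "annulus_weight v \<ge> 0"
  by (simp add: annulus_weight_def annulus_bump_def)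

lemma S3_int_bound:
  assumes "continuous_on S3 F" "\<And>x. x \<in> S3 \<Longrightarrow> norm (F x) \<le> M"
  shows "norm (S3_int F) \<le> M * norm (S3_int (\<lambda>x. 1))"
proof -
  have i1: "integrable lborel (\<lambda>v. annulus_weight v *\<^sub>R (1::complex))"
    using integrable_weighted_hom_ext[of "\<lambda>x. 1"] by (simp add: hom_ext_def)
  then have i: "integrable lborel annulus_weight"
    by (simp add: scaleR_conv_of_real complex_of_real_integrable_eq)
  have le: "norm (annulus_weight v *\<^sub>R hom_ext F v) \<le> M * annulus_weight v" for v
  proof (cases "v = 0")
    case True
    then show ?thesis by (simp add: annulus_weight_def)
  next
    case False
    then have "norm (hom_ext F v) \<le> M" unfolding hom_ext_def by (intro assms(2)) (simp add: S3_def)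
    then show ?thesis using annulus_weight_nonneg[of v] by (simp add: mult.commute[of M] mult_left_mono)
  qed
  have "norm (S3_int F) \<le> (LINT v|lborel. norm (annulus_weight v *\<^sub>R hom_ext F v))"
    unfolding S3_int_def by (rule integral_norm_bound)
  also have "\<dots> \<le> (LINT v|lborel. M * annulus_weight v)"
    using i le by (intro integral_mono integrable_norm integrable_weighted_hom_ext assms(1)) auto
  also have "\<dots> = M * (LINT v|lborel. annulus_weight v)" by simp
  also have "(LINT v|lborel. annulus_weight v) = norm (S3_int (\<lambda>x. 1))"
    using annulus_weight_nonneg
    by (simp add: S3_int_def hom_ext_def scaleR_conv_of_real integral_nonneg_AE)
  finally show ?thesis .
qed

lemma S3_int_norm_square_eq_0:
  assumes F: "continuous_on S3 F" and 0: "S3_int (\<lambda>x. F x * cnj (F x)) = 0" and x: "x \<in> S3"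
  shows "F x = 0"
proof -
  define g where "g v = annulus_weight v * (norm (hom_ext F v))\<^sup>2" for v
  have g: "complex_of_real (g v) = annulus_weight v *\<^sub>R hom_ext (\<lambda>x. F x * cnj (F x)) v" for v
    by (simp add: g_def hom_ext_def scaleR_conv_of_real flip: complex_norm_square)
  have cF: "continuous_on S3 (\<lambda>x. F x * cnj (F x))" by (intro continuous_intros F)
  have "continuous_on UNIV (\<lambda>v. complex_of_real (g v))"
    unfolding g by (rule continuous_on_weighted_hom_ext[OF cF])
  then have contg: "continuous_on UNIV g" using continuous_on_Re by fastforce
  have "integrable lborel (\<lambda>v. complex_of_real (g v))" unfolding g by (rule integrable_weighted_hom_ext[OF cF])
  then have ig: "integrable lborel g" by (simp only: complex_of_real_integrable_eq)
  have "complex_of_real (LINT v|lborel. g v) = 0"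
    using 0 unfolding S3_int_def g[symmetric] integral_complex_of_real .
  then have "(LINT v|lborel. g v) = 0" by simp
  moreover have "g v \<ge> 0" for v by (simp add: g_def annulus_weight_nonneg)
  ultimately have "AE v in lborel. g v = 0"
    using integral_nonneg_eq_0_iff_AE[OF ig] by simp
  then have "AE v in lebesgue. v \<in> {v. g v = 0}" by (auto intro: AE_completion)
  moreover have "closed {v. g v = 0}" using contg by (intro closed_Collect_eq continuous_intros)
  \<comment> \<open>The weight vanishes on the sphere itself, so F x is read off at radius 3/2,
    strictly inside the annulus, where the weight is positive. An almost everywhere zero of a
    continuous function is a zero everywhere.\<close>
  ultimately have "(3 / 2) *\<^sub>R x \<in> {v. g v = 0}" by (intro mem_closed_if_AE_lebesgue)
  moreover have "x \<bullet> x = 1" using x by (simp add: S3_def norm_eq_1)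
  moreover have "x \<noteq> 0" using calculation(2) by auto
  ultimately show ?thesis
    using x by (simp add: g_def annulus_weight_def annulus_bump_def hom_ext_scaleR hom_ext_S3)
qed

section \<open>Inner product and orthogonal projection\<close>

definition S3_ip :: "(pt \<Rightarrow> complex) \<Rightarrow> (pt \<Rightarrow> complex) \<Rightarrow> complex" where
  "S3_ip F Q = S3_int (\<lambda>x. F x * cnj (Q x))"

text \<open>Fixing the value 0 off the sphere makes the inner product definite: norm 0 forces
  equality with the zero function on the whole space.\<close>

definition S3_cont :: "(pt \<Rightarrow> complex) set" where
  "S3_cont = {F. continuous_on S3 F \<and> (\<forall>x. x \<notin> S3 \<longrightarrow> F x = 0)}"

lemma S3_contD: "F \<in> S3_cont \<Longrightarrow> continuous_on S3 F"
  by (simp add: S3_cont_def)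

lemma subspace_S3_cont: "fs.subspace S3_cont"
  by (rule fs.subspaceI)
     (auto simp: S3_cont_def fscale_def zero_fun_def plus_fun_def intro!: continuous_intros)

lemma S3_ip_add_left: "F \<in> S3_cont \<Longrightarrow> Q \<in> S3_cont \<Longrightarrow> P \<in> S3_cont \<Longrightarrow> S3_ip (F + Q) P = S3_ip F P + S3_ip Q P"
  unfolding S3_ip_def by (subst S3_int_add[symmetric]) (auto simp: algebra_simps intro!: continuous_intros dest: S3_contD)

lemma S3_ip_add_right: "F \<in> S3_cont \<Longrightarrow> Q \<in> S3_cont \<Longrightarrow> P \<in> S3_cont \<Longrightarrow> S3_ip P (F + Q) = S3_ip P F + S3_ip P Q"
  unfolding S3_ip_def by (subst S3_int_add[symmetric]) (auto simp: algebra_simps intro!: continuous_intros dest: S3_contD)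

lemma S3_ip_scale_left: "S3_ip (fscale c F) P = c * S3_ip F P"
  unfolding S3_ip_def fscale_def S3_int_cmult[symmetric] by (simp add: mult.assoc)

lemma S3_ip_scale_right: "S3_ip P (fscale c F) = cnj c * S3_ip P F"
  unfolding S3_ip_def fscale_def S3_int_cmult[symmetric] by (simp add: mult_ac)

lemma S3_ip_diff_left:
  assumes "F \<in> S3_cont" "Q \<in> S3_cont" "P \<in> S3_cont"
  shows "S3_ip (F - Q) P = S3_ip F P - S3_ip Q P"
proof -
  have "F - Q = F + fscale (-1) Q" by (simp add: fun_eq_iff fscale_def)
  moreover have "fscale (-1) Q \<in> S3_cont" using assms(2) by (rule fs.subspace_scale[OF subspace_S3_cont])
  ultimately show ?thesis
    using assms by (simp only: S3_ip_add_left S3_ip_scale_left) simp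
qed

lemma S3_ip_diff_right:
  assumes "F \<in> S3_cont" "Q \<in> S3_cont" "P \<in> S3_cont"
  shows "S3_ip P (F - Q) = S3_ip P F - S3_ip P Q"
proof -
  have "F - Q = F + fscale (-1) Q" by (simp add: fun_eq_iff fscale_def)
  moreover have "fscale (-1) Q \<in> S3_cont" using assms(2) by (rule fs.subspace_scale[OF subspace_S3_cont])
  ultimately show ?thesis
    using assms by (simp only: S3_ip_add_right S3_ip_scale_right) simp
qed

lemma S3_ip_self_eq_0:
  assumes "F \<in> S3_cont" "S3_ip F F = 0"
  shows "F = 0"
proof
  fix x
  show "F x = 0 x"
    using assms S3_int_norm_square_eq_0[of F x] unfolding S3_cont_def S3_ip_def mem_Collect_eq zero_fun_def
    by (cases "x \<in> S3") blast+
qed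

lemma span_subset_S3_cont: "B \<subseteq> S3_cont \<Longrightarrow> Q \<in> fs.span B \<Longrightarrow> Q \<in> S3_cont"
  using fs.span_minimal[OF _ subspace_S3_cont] by blast

lemma S3_ip_span_eq_0:
  assumes "B \<subseteq> S3_cont" "F \<in> S3_cont" "\<And>b. b \<in> B \<Longrightarrow> S3_ip F b = 0" "Q \<in> fs.span B"
  shows "S3_ip F Q = 0"
proof -
  have "Q \<in> S3_cont \<and> S3_ip F Q = 0"
    using assms(4)
  proof (induction rule: fs.span_induct_alt)
    case base
    have "S3_ip F (fscale 0 0) = 0" by (simp only: S3_ip_scale_right) simp
    then show ?case using fs.subspace_0[OF subspace_S3_cont] by (simp only: fs.scale_zero_left conj_absorb)
  next
    case (step c x y)
    then have x: "x \<in> S3_cont" "S3_ip F x = 0" using assms(1,3) by blast+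
    have cx: "fscale c x \<in> S3_cont" using x(1) by (rule fs.subspace_scale[OF subspace_S3_cont])
    have "S3_ip F (fscale c x + y) = 0"
      using step x cx assms(2) by (simp only: S3_ip_add_right S3_ip_scale_right) simp
    moreover have "fscale c x + y \<in> S3_cont" using cx step by (blast intro: fs.subspace_add[OF subspace_S3_cont])
    ultimately show ?case by (simp only: plus_fun_def conj_absorb)
  qed
  then show ?thesis ..
qed

text \<open>One Gram-Schmidt step per element. The induction hypothesis is applied to F and also to
  the new element x, hence the generalization over F. If the residual y of x has norm 0, then x lies
  in the span already and the old projection serves.\<close>

lemma S3_projection:
  assumes "finite B" "B \<subseteq> S3_cont" "F \<in> S3_cont"
  shows "\<exists>P\<in>fs.span B. \<forall>b\<in>B. S3_ip (F - P) b = 0"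
  using assms
proof (induction arbitrary: F rule: finite_induct)
  case empty
  then show ?case using fs.span_zero by blast
next
  case (insert x B)
  then have x: "x \<in> S3_cont" and B: "B \<subseteq> S3_cont" and F: "F \<in> S3_cont" by auto
  note sub = fs.subspace_add[OF subspace_S3_cont] fs.subspace_diff[OF subspace_S3_cont] fs.subspace_scale[OF subspace_S3_cont]
  note cB = span_subset_S3_cont[OF B]
  obtain P where P: "P \<in> fs.span B" "\<forall>b\<in>B. S3_ip (F - P) b = 0" using insert.IH[OF B F] by blast
  obtain X where X: "X \<in> fs.span B" "\<forall>b\<in>B. S3_ip (x - X) b = 0" using insert.IH[OF B x] by blast
  define y where "y = x - X"
  have y: "y \<in> S3_cont" unfolding y_def using x cB[OF X(1)] by (rule sub)
  have FP: "F - P \<in> S3_cont" using F cB[OF P(1)] by (rule sub)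
  have mono: "fs.span B \<subseteq> fs.span (insert x B)" by (intro fs.span_mono) auto
  show ?case
  proof (cases "S3_ip y y = 0")
    case True
    then have "y = 0" by (rule S3_ip_self_eq_0[OF y])
    then have "x \<in> fs.span B" using X by (simp add: y_def)
    then have "S3_ip (F - P) x = 0" using S3_ip_span_eq_0[OF B FP] P(2) by blast
    then show ?thesis using P mono by blast
  next
    case False
    \<comment> \<open>The Fourier coefficient along y: subtracting \<open>fscale c y\<close> makes
      the remainder orthogonal to y, and y is orthogonal to B, so nothing gained before is
      lost.\<close>
    define c where "c = S3_ip (F - P) y / S3_ip y y"
    define P' where "P' = P + fscale c y"
    have cy: "fscale c y \<in> S3_cont" using y by (rule sub)
    have FP': "F - P' = (F - P) - fscale c y" by (simp add: P'_def)
    have FP'c: "F - P' \<in> S3_cont" unfolding FP' using FP cy by (rule sub)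
    have b: "S3_ip (F - P') b = 0" if "b \<in> B" for b
      using that B P(2) X(2) FP cy unfolding FP'
      by (subst S3_ip_diff_left) (auto simp: S3_ip_scale_left y_def)
    have "S3_ip (F - P') y = 0"
      unfolding FP' using FP cy y False by (simp add: S3_ip_diff_left S3_ip_scale_left c_def)
    moreover have "S3_ip (F - P') X = 0"
      using S3_ip_span_eq_0[OF B FP'c] b X(1) by blast
    moreover have "x = y + X" by (simp add: y_def)
    ultimately have "S3_ip (F - P') x = 0"
      using S3_ip_add_right[OF y cB[OF X(1)] FP'c] by simp
    moreover have "P' \<in> fs.span (insert x B)"
    proof -
      have "P \<in> fs.span (insert x B)" "X \<in> fs.span (insert x B)" using P X mono by auto
      moreover have "x \<in> fs.span (insert x B)" by (simp add: fs.span_base)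
      ultimately show ?thesis unfolding P'_def y_def by (intro fs.span_add fs.span_scale fs.span_diff)
    qed
    ultimately show ?thesis using b by blast
  qed
qed

section \<open>Every eigenfunction is a combination of siblings\<close>

lemma S3_laplace_eigen_continuous:
  assumes "S3_laplace_eigen F c"
  shows "continuous_on S3 F"
proof -
  obtain D D2 where "hom_partials F D D2" using assms unfolding S3_laplace_eigen_iff by blast
  then have "continuous_on (- {0}) (hom_ext F)" by (rule hom_partials_continuous)
  then have "continuous_on S3 (hom_ext F)" by (rule continuous_on_subset) (auto simp: S3_def)
  then show ?thesis by (subst continuous_on_cong[OF refl]) (auto simp: hom_ext_S3)
qed

lemma restr_sib_S3_cont: "restrS3 (sib a b j) \<in> S3_cont"
  by (simp add: S3_cont_def continuous_on_restrS3 continuous_on_sib) (simp add: restrS3_def)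

lemma S3_ip_eigen_eq_0:
  assumes "S3_laplace_eigen F c" "S3_laplace_eigen Q d" "c \<noteq> cnj d"
  shows "S3_ip F Q = 0"
  using integral_eigen_orthogonal[OF assms(1) S3_laplace_eigen_cnj[OF assms(2)] assms(3)]
  by (simp add: S3_ip_def S3_int_def hom_ext_def)

text \<open>For a polynomial Q uniformly e-close to G on the sphere, orthogonality gives <G, G> =
  <G, G - Q>, which is at most e times a constant independent of Q.\<close>

lemma orthogonal_sib_span_eq_0:
  assumes G: "G \<in> S3_cont" and orth: "\<And>a b j. S3_ip G (restrS3 (sib a b j)) = 0"
  shows "G = 0"
proof (rule S3_ip_self_eq_0[OF G])
  have comp: "compact S3" unfolding S3_def
    using compact_sphere[of "0::pt" 1] by (simp add: sphere_def dist_norm)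
  have contG: "continuous_on S3 G" using G by (rule S3_contD)
  have "bounded (G ` S3)" by (intro compact_imp_bounded compact_continuous_image contG comp)
  then obtain M where M: "\<forall>x\<in>S3. norm (G x) \<le> M" by (auto simp: bounded_iff)
  define K where "K = M * norm (S3_int (\<lambda>x. 1))"
  have le: "norm (S3_ip G G) \<le> e * K" if e: "e > 0" for e
  proof -
    obtain g where g: "polynomial_function g" "\<forall>x\<in>S3. norm (G x - g x) < e"
      using Stone_Weierstrass_polynomial_function[OF comp contG e] by blast
    define Q where "Q = restrS3 g"
    have Q: "Q \<in> S3_cont"
      using continuous_on_polymonial_function[OF g(1)] by (simp add: Q_def S3_cont_def continuous_on_restrS3) (simp add: restrS3_def)
    have "S3_ip G Q = 0"
    proof (rule S3_ip_span_eq_0[OF _ G])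
      show "{restrS3 (sib a b j) | a b j. True} \<subseteq> S3_cont" using restr_sib_S3_cont by blast
      show "S3_ip G b = 0" if "b \<in> {restrS3 (sib a b j) | a b j. True}" for b using orth that by blast
      show "Q \<in> fs.span {restrS3 (sib a b j) | a b j. True}"
        using polynomial_function_sib_span[OF g(1)] by (simp only: Q_def sib_span_def)
    qed
    then have "S3_ip G G = S3_ip G (G - Q)"
      using S3_ip_diff_right[OF G Q G] by simp
    moreover have "norm (S3_ip G (G - Q)) \<le> (M * e) * norm (S3_int (\<lambda>x. 1))"
      unfolding S3_ip_def
    proof (rule S3_int_bound)
      show "continuous_on S3 (\<lambda>x. G x * cnj ((G - Q) x))"
        using contG S3_contD[OF Q] by (auto intro!: continuous_intros)
      fix x assume x: "x \<in> S3"
      then have "norm (G x - Q x) \<le> e" using g(2) by (auto simp: Q_def restrS3_def less_imp_le)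
      moreover have "norm (G x) \<le> M" using M x by blast
      moreover have "0 \<le> M" using calculation(2) norm_ge_zero order_trans by blast
      ultimately show "norm (G x * cnj ((G - Q) x)) \<le> M * e"
        by (simp add: norm_mult mult_mono del: complex_cnj_diff)
    qed
    ultimately show ?thesis by (simp add: K_def mult_ac)
  qed
  show "S3_ip G G = 0"
  proof (rule ccontr)
    assume "S3_ip G G \<noteq> 0"
    then have pos: "norm (S3_ip G G) > 0" by simp
    with le[of 1] have K: "K > 0" by linarith
    \<comment> \<open>Takes e = |<G, G>| / (2 K), admissible because the bound at e = 1 forces K >
      0.\<close>
    have "norm (S3_ip G G) \<le> norm (S3_ip G G) / 2"
      using le[of "norm (S3_ip G G) / (2 * K)"] pos K by simp
    with pos show False by simp
  qed
qed

lemma eigenfunction_in_sib_span: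
  assumes F: "S3_laplace_eigen F (- of_nat (k * (k + 2)))" and F0: "\<And>x. x \<notin> S3 \<Longrightarrow> F x = 0"
  shows "F \<in> fs.span {restrS3 (sib a b j) | a b j. a + b = k \<and> j \<le> k}" (is "F \<in> fs.span ?B")
proof -
  let ?c = "- of_nat (k * (k + 2)) :: complex"
  have "?B \<subseteq> (\<lambda>(a, b, j). restrS3 (sib a b j)) ` ({..k} \<times> {..k} \<times> {..k})"
  proof
    fix F assume "F \<in> ?B"
    then obtain a b j where "F = restrS3 (sib a b j)" "a + b = k" "j \<le> k" by blast
    then show "F \<in> (\<lambda>(a, b, j). restrS3 (sib a b j)) ` ({..k} \<times> {..k} \<times> {..k})"
      by (intro image_eqI[of _ _ "(a, b, j)"]) auto
  qed
  then have fin: "finite ?B" by (rule finite_subset) auto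
  have B: "?B \<subseteq> S3_cont" by (auto intro: restr_sib_S3_cont)
  have Fc: "F \<in> S3_cont" using S3_laplace_eigen_continuous[OF F] F0 by (simp add: S3_cont_def)
  obtain P where P: "P \<in> fs.span ?B" "\<forall>b\<in>?B. S3_ip (F - P) b = 0"
    using S3_projection[OF fin B Fc] by blast
  have "S3_laplace_eigen P ?c"
    using P(1)
  proof (induction rule: fs.span_induct_alt)
    case base
    show ?case by (rule S3_laplace_eigen_zero)
  next
    case (step c x y)
    then obtain a b j where "x = restrS3 (sib a b j)" "a + b = k" by blast
    then have "S3_laplace_eigen x ?c" using S3_laplace_eigen_sib[of a b j] by simp
    then show ?case using step by (intro S3_laplace_eigen_add S3_laplace_eigen_fscale)
  qed
  moreover have "F - P = F + fscale (-1) P" by (simp add: fun_eq_iff fscale_def)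
  ultimately have eig: "S3_laplace_eigen (F - P) ?c"
    using F by (simp only: S3_laplace_eigen_add S3_laplace_eigen_fscale)
  have G: "F - P \<in> S3_cont"
    using Fc span_subset_S3_cont[OF B P(1)] by (rule fs.subspace_diff[OF subspace_S3_cont])
  have "F - P = 0"
  proof (rule orthogonal_sib_span_eq_0[OF G])
    fix a b j
    \<comment> \<open>Siblings of the own degree are orthogonal by projection, those with j beyond
      the degree are 0, and other degrees have another eigenvalue.\<close>
    consider "a + b = k" "j \<le> k" | "a + b = k" "j > k" | "a + b \<noteq> k" by linarith
    then show "S3_ip (F - P) (restrS3 (sib a b j)) = 0"
    proof cases
      case 1
      then show ?thesis using P(2) by blast
    next
      case 2
      then have "restrS3 (sib a b j) = fscale 0 0" by (auto simp: fun_eq_iff restrS3_def fscale_def sib_eq_0)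
      then show ?thesis by (simp only: S3_ip_scale_right) simp
    next
      case 3
      \<comment> \<open>k (k + 2) is strictly increasing in k, so the eigenvalue determines the
        degree.\<close>
      have "(a + b) * (a + b + 2) \<noteq> k * (k + 2)"
      proof (rule linorder_cases[of "a + b" k])
        assume "a + b < k"
        then have "(a + b) * (a + b + 2) < k * (k + 2)" by (intro mult_strict_mono) auto
        then show ?thesis by simp
      next
        assume "a + b > k"
        then have "k * (k + 2) < (a + b) * (a + b + 2)" by (intro mult_strict_mono) auto
        then show ?thesis by simp
      qed (use 3 in simp)
      then have "?c \<noteq> cnj (- of_nat ((a + b) * (a + b + 2)))"
        unfolding complex_cnj_minus complex_cnj_of_nat neg_equal_iff_equal of_nat_eq_iff by simp
      then show ?thesis using S3_ip_eigen_eq_0[OF eig S3_laplace_eigen_sib] by blast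
    qed
  qed
  then show ?thesis using P(1) by simp
qed

section \<open>Torus weights and independence\<close>

text \<open>Since 1/x = cnj x and 1/y = cnj y, rotating the coordinates turns the factors into x
  (alpha - s cnj beta) and y (beta + s cnj alpha) with s = t cnj x cnj y; rescaling t multiplies the
  j-th coefficient by (cnj x cnj y)^j.\<close>

lemma sib_torus:
  assumes x: "x * cnj x = 1" and y: "y * cnj y = 1"
  shows "sib a b j (x * fst v, y * snd v) = x ^ a * y ^ b * (cnj x * cnj y) ^ j * sib a b j v"
proof -
  have x': "cnj (x * z) * S = cnj z * y * (S * (cnj x * cnj y))" for z S
  proof -
    have "cnj z * y * (S * (cnj x * cnj y)) = (y * cnj y) * (cnj x * cnj z * S)" by (simp only: mult_ac)
    then show ?thesis using y by simp
  qed
  have y': "cnj (y * z) * S = cnj z * x * (S * (cnj x * cnj y))" for z S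
  proof -
    have "cnj z * x * (S * (cnj x * cnj y)) = (x * cnj x) * (cnj y * cnj z * S)" by (simp only: mult_ac)
    then show ?thesis using x by simp
  qed
  have lag: "sib_lag a b j (x * fst v, y * snd v) * (cnj x * cnj y) = x ^ a * y ^ b * (cnj x * cnj y) ^ j * sib_lag a b j v"
    if "\<And>j. sib a b j (x * fst v, y * snd v) = x ^ a * y ^ b * (cnj x * cnj y) ^ j * sib a b j v" for a b j
    using that by (cases j) simp_all
  show ?thesis
  proof (induction a arbitrary: j)
    case 0
    show ?case
    proof (induction b arbitrary: j)
      case 0
      show ?case by (simp add: sib_0_0)
    next
      case (Suc b)
      have "sib 0 (Suc b) j (x * fst v, y * snd v)
        = y * snd v * sib 0 b j (x * fst v, y * snd v) + cnj (fst v) * y * (sib_lag 0 b j (x * fst v, y * snd v) * (cnj x * cnj y))"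
        by (simp only: sib_Suc_right fst_conv snd_conv x')
      then show ?case unfolding lag[OF Suc] Suc by (simp add: sib_Suc_right algebra_simps)
    qed
  next
    case (Suc a)
    have "sib (Suc a) b j (x * fst v, y * snd v)
      = x * fst v * sib a b j (x * fst v, y * snd v) - cnj (snd v) * x * (sib_lag a b j (x * fst v, y * snd v) * (cnj x * cnj y))"
      by (simp only: sib_Suc_left fst_conv snd_conv y')
    then show ?case unfolding lag[OF Suc] Suc by (simp add: sib_Suc_left algebra_simps)
  qed
qed

lemma dsib_eq_0:
  assumes "\<And>v. sib a b j v = 0"
  shows "dsib a b j v h = 0"
proof -
  have "sib a b j = (\<lambda>v. 0)" using assms by (simp add: fun_eq_iff)
  then have "((\<lambda>v. 0) has_derivative dsib a b j v) (at v)" using has_derivative_sib[of a b j v] by simp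
  then show ?thesis using has_derivative_unique[OF has_derivative_const] by metis
qed

text \<open>If a sibling vanished identically, so would its derivative, and the complex-linear and
  conjugate-linear parts of that derivative are siblings of degree one less. The induction thus
  descends to the constant 1.\<close>

lemma sib_not_identically_0: "j \<le> a + b \<Longrightarrow> \<exists>v. sib a b j v \<noteq> 0"
proof (induction "a + b" arbitrary: a b j)
  case 0
  then show ?case by (simp add: sib_0_0)
next
  case (Suc n)
  show ?case
  proof (rule ccontr)
    assume "\<not> ?thesis"
    then have z: "dsib a b j v h = 0" for v h using dsib_eq_0 by blast
    \<comment> \<open>The derivatives along 1 and i are P + Q and i P - i Q, where P is the
      complex-linear and Q the conjugate-linear part; together they separate the two.\<close>
    have lin: "P = 0 \<and> Q = 0" if "P + Q = 0" "\<i> * P - \<i> * Q = 0" for P Q :: complex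
    proof -
      have "\<i> * (P - Q) = 0" using that(2) by (simp add: right_diff_distrib)
      then have "P = Q" by simp
      then show ?thesis using that(1) by simp
    qed
    have "of_nat a * sib (a - 1) b j v = 0 \<and> of_nat b * sib_lag a (b - 1) j v = 0" for v
      by (rule lin) (use z[of v "(1, 0)"] z[of v "(\<i>, 0)"] in \<open>simp_all add: dsib_def mult_ac\<close>)
    moreover have "of_nat b * sib a (b - 1) j v = 0 \<and> - (of_nat a * sib_lag (a - 1) b j v) = 0" for v
      by (rule lin) (use z[of v "(0, 1)"] z[of v "(0, \<i>)"] in \<open>simp_all add: dsib_def mult_ac add_ac\<close>)
    ultimately have z': "a > 0 \<Longrightarrow> sib (a - 1) b j v = 0" "b > 0 \<Longrightarrow> sib_lag a (b - 1) j v = 0"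
        "b > 0 \<Longrightarrow> sib a (b - 1) j v = 0" "a > 0 \<Longrightarrow> sib_lag (a - 1) b j v = 0" for v by auto
    show False
    proof (cases "a > 0")
      case True
      then have n: "n = (a - 1) + b" using Suc.hyps(2) by simp
      show False
      proof (cases "j \<le> n")
        case le: True
        from Suc.hyps(1)[OF n] le n z'(1)[OF True] show False by metis
      next
        case False
        \<comment> \<open>At the top index the complex-linear part is 0 for degree reasons, so the
          lagged, conjugate-linear part supplies the contradiction.\<close>
        then have "j = Suc n" using Suc.hyps(2) Suc.prems by simp
        with z'(4)[OF True] have "sib (a - 1) b n v = 0" for v by simp
        with Suc.hyps(1)[OF n] n show False by (metis order_refl)
      qed
    next
      case a: False
      then have b: "b > 0" and n: "n = a + (b - 1)" using Suc.hyps(2) by simp_all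
      show False
      proof (cases "j \<le> n")
        case le: True
        from Suc.hyps(1)[OF n] le n z'(3)[OF b] show False by metis
      next
        case False
        then have "j = Suc n" using Suc.hyps(2) Suc.prems by simp
        with z'(2)[OF b] have "sib a (b - 1) n v = 0" for v by simp
        with Suc.hyps(1)[OF n] n show False by (metis order_refl)
      qed
    qed
  qed
qed

lemma restr_sib_neq_0:
  assumes "j \<le> a + b"
  shows "restrS3 (sib a b j) \<noteq> 0"
proof
  assume "restrS3 (sib a b j) = 0"
  then have z: "sib a b j v = 0" if "v \<in> S3" for v
    using that \<open>restrS3 (sib a b j) = 0\<close> by (metis restrS3_def zero_fun_apply)
  obtain v where v: "sib a b j v \<noteq> 0" using sib_not_identically_0[OF assms] by blast
  show False
  proof (cases "v = 0")
    case True
    \<comment> \<open>Homogeneity carries a nonzero value to the sphere unless it occurs at the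
      origin, which happens in degree 0 only.\<close>
    have "a + b = 0"
    proof (rule ccontr)
      assume "a + b \<noteq> 0"
      then have "(0::real) ^ (a + b) = 0" by (metis zero_power neq0_conv)
      then have "sib a b j (0 *\<^sub>R 0) = 0" by (simp only: sib_scaleR) simp
      then show False using v True by simp
    qed
    moreover have "(1, 0) \<in> S3" by (simp add: S3_iff)
    ultimately show False using z[of "(1, 0)"] assms by (simp add: sib_0_0)
  next
    case False
    then have "inverse (norm v) *\<^sub>R v \<in> S3" by (simp add: S3_def)
    from z[OF this] show False using v False by (simp add: sib_scaleR)
  qed
qed

text \<open>Composing a relation with \<open>\<tau>\<close> and subtracting \<open>l k\<close> times
  the relation removes the k-th term and multiplies every other coefficient by a nonzero difference
  of eigenvalues.\<close>

lemma eigenfunctions_independent: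
  fixes f :: "'i \<Rightarrow> 'b \<Rightarrow> 'c::field"
  assumes "finite I" "\<And>i x. i \<in> I \<Longrightarrow> f i (\<tau> x) = l i * f i x" "inj_on l I" "\<And>i. i \<in> I \<Longrightarrow> \<exists>x. f i x \<noteq> 0"
    and "\<And>x. (\<Sum>i\<in>I. c i * f i x) = 0" "i \<in> I"
  shows "c i = 0"
  using assms
proof (induction arbitrary: c i rule: finite_induct)
  case empty
  then show ?case by simp
next
  case (insert k I)
  have "(\<Sum>i\<in>I. c i * (l i - l k) * f i x) = 0" for x
  proof -
    have "(\<Sum>i\<in>insert k I. c i * (l i - l k) * f i x)
        = (\<Sum>i\<in>insert k I. c i * f i (\<tau> x)) - l k * (\<Sum>i\<in>insert k I. c i * f i x)"
      unfolding sum_distrib_left sum_subtractf[symmetric]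
      by (intro sum.cong refl) (simp only: insert.prems(1), simp add: algebra_simps)
    then show ?thesis using insert.prems(4) insert.hyps by simp
  qed
  then have "c i * (l i - l k) = 0" if "i \<in> I" for i
    by (intro insert.IH[of "\<lambda>i. c i * (l i - l k)"]) (use insert.prems that in \<open>auto intro: inj_on_subset\<close>)
  moreover have "l i \<noteq> l k" if "i \<in> I" for i
    using insert.prems(2) insert.hyps(2) that by (auto simp: inj_on_def)
  ultimately have I: "c i = 0" if "i \<in> I" for i using that by fastforce
  obtain x where "f k x \<noteq> 0" using insert.prems(3) by blast
  then have "c k = 0" using insert.prems(4)[of x] insert.hyps I by simp
  then show ?case using I insert.prems(5) by blast
qed

text \<open>Indexed by (b, j) with a = k - b, so that the index set for degree k is a square; the
  factorial makes it the j-th twist exactly.\<close>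

definition scaled_sib :: "nat \<Rightarrow> nat \<times> nat \<Rightarrow> pt \<Rightarrow> complex" where
  "scaled_sib k i = fscale (fact (snd i)) (restrS3 (sib (k - fst i) (fst i) (snd i)))"

lemma scaled_sib_eq: "restrS3 ((twist_minus ^^ j) (monomial (k - b) b)) = scaled_sib k (b, j)"
  by (simp add: funpow_twist_minus_monomial scaled_sib_def fscale_def restrS3_def fun_eq_iff)

lemma torus_S3_iff:
  assumes "x * cnj x = 1" "y * cnj y = 1"
  shows "(x * fst v, y * snd v) \<in> S3 \<longleftrightarrow> v \<in> S3"
proof -
  have "x * fst v * cnj (x * fst v) + y * snd v * cnj (y * snd v)
     = (x * cnj x) * (fst v * cnj (fst v)) + (y * cnj y) * (snd v * cnj (snd v))" by (simp add: algebra_simps)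
  then show ?thesis using assms by (simp add: S3_iff)
qed

lemma scaled_sib_torus:
  assumes "x * cnj x = 1" "y * cnj y = 1"
  shows "scaled_sib k (b, j) (x * fst v, y * snd v)
       = x ^ (k - b) * y ^ b * (cnj x * cnj y) ^ j * scaled_sib k (b, j) v"
  using torus_S3_iff[OF assms, of v] sib_torus[OF assms, of "k - b" b j v]
  by (simp add: scaled_sib_def fscale_def restrS3_def)

lemma scaled_sib_neq_0:
  assumes "b \<le> k" "j \<le> k"
  shows "\<exists>v. scaled_sib k (b, j) v \<noteq> 0"
proof -
  have "restrS3 (sib (k - b) b j) \<noteq> 0" using assms by (intro restr_sib_neq_0) simp
  then show ?thesis by (auto simp: scaled_sib_def fscale_def fun_eq_iff)
qed

text \<open>A rotation of the torus whose eigenvalue on the sibling with index (b, j) is, up to a constant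
  factor, the root of unity of order (k + 1)^2 with exponent b + (k + 1) j.\<close>
lemma separating_torus_element:
  obtains x y :: complex where "x * cnj x = 1" "y * cnj y = 1"
    "inj_on (\<lambda>(b, j). x ^ (k - b) * y ^ b * (cnj x * cnj y) ^ j) ({..k} \<times> {..k})"
proof -
  define N where "N = (k + 1) * (k + 1)"
  \<comment> \<open>The angles of x and y solve two conditions: y / x turns by u, which counts b,
    and cnj x cnj y turns by w = (k + 1) u, which counts j.\<close>
  define u :: real where "u = 2 * pi / N"
  define w where "w = u * (k + 1)"
  define x where "x = cis (- (u + w) / 2)"
  define y where "y = cis ((u - w) / 2)"
  have xy: "x * cnj x = 1" "y * cnj y = 1" by (simp_all add: x_def y_def cis_cnj cis_mult)
  have l: "x ^ (k - b) * y ^ b * (cnj x * cnj y) ^ j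
     = cis (- (u + w) / 2 * k) * cis (2 * pi * real (b + (k + 1) * j) / real N)" if "b \<le> k" for b j
  proof -
    have "x ^ (k - b) * y ^ b * (cnj x * cnj y) ^ j
      = cis (real (k - b) * (- (u + w) / 2) + real b * ((u - w) / 2) + real j * ((u + w) / 2 - (u - w) / 2))"
      unfolding x_def y_def cis_cnj Complex.DeMoivre cis_mult
      by (rule arg_cong[where f = cis]) (simp add: field_simps)
    also have "real (k - b) * (- (u + w) / 2) + real b * ((u - w) / 2) + real j * ((u + w) / 2 - (u - w) / 2)
      = - (u + w) / 2 * k + u * (b + (k + 1) * j)"
      using that by (simp add: of_nat_diff w_def field_simps)
    also have "u * (b + (k + 1) * j) = 2 * pi * real (b + (k + 1) * j) / real N" by (simp add: u_def)
    finally show ?thesis by (simp add: cis_mult)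
  qed
  have "inj_on (\<lambda>(b, j). x ^ (k - b) * y ^ b * (cnj x * cnj y) ^ j) ({..k} \<times> {..k})"
  proof (rule inj_onI, clarsimp)
    fix b j b' j'
    assume le: "b \<le> k" "j \<le> k" "b' \<le> k" "j' \<le> k"
      and eq: "x ^ (k - b) * y ^ b * (cnj x * cnj y) ^ j = x ^ (k - b') * y ^ b' * (cnj x * cnj y) ^ j'"
    have lt: "b + (k + 1) * j < N" if "b \<le> k" "j \<le> k" for b j
    proof -
      have "(k + 1) * j \<le> (k + 1) * k" using that by (intro mult_left_mono) auto
      then show ?thesis using that by (simp add: N_def algebra_simps)
    qed
    have "cis (2 * pi * real (b + (k + 1) * j) / real N) = cis (2 * pi * real (b' + (k + 1) * j') / real N)"
      using eq unfolding l[OF le(1)] l[OF le(3)] by simp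
    moreover have "inj_on (\<lambda>k. cis (2 * pi * real k / real N)) {..<N}"
      using Complex.bij_betw_roots_unity[of N] by (auto simp: bij_betw_def N_def)
    ultimately have e: "b + (k + 1) * j = b' + (k + 1) * j'"
      using lt[OF le(1,2)] lt[OF le(3,4)] by (auto simp: inj_on_def)
    \<comment> \<open>b and j are the two digits of the exponent in base k + 1.\<close>
    have m: "(b + (k + 1) * j) mod (k + 1) = b" if "b \<le> k" for b j
      using that by (simp only: mod_mult_self2) simp
    have "b = b'" using m[OF le(1), of j] m[OF le(3), of j'] unfolding e by simp
    with e have "(k + 1) * j = (k + 1) * j'" by simp
    then have "j = j'" by (simp only: mult_cancel1) simp
    with \<open>b = b'\<close> show "b = b' \<and> j = j'" ..
  qed
  with xy that show ?thesis by blast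
qed

lemma scaled_sib_independent:
  assumes "I \<subseteq> {..k} \<times> {..k}" "\<And>v. (\<Sum>i\<in>I. c i * scaled_sib k i v) = 0" "i \<in> I"
  shows "c i = 0"
proof -
  obtain x y :: complex where xy: "x * cnj x = 1" "y * cnj y = 1"
    and inj: "inj_on (\<lambda>(b, j). x ^ (k - b) * y ^ b * (cnj x * cnj y) ^ j) ({..k} \<times> {..k})"
    by (rule separating_torus_element)
  show ?thesis
  proof (rule eigenfunctions_independent[where f = "scaled_sib k" and \<tau> = "\<lambda>v. (x * fst v, y * snd v)"])
    show "finite I" using assms(1) by (rule finite_subset) auto
    show "inj_on (\<lambda>(b, j). x ^ (k - b) * y ^ b * (cnj x * cnj y) ^ j) I" using inj assms(1) by (rule inj_on_subset)
    show "scaled_sib k i (x * fst v, y * snd v)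
        = (case i of (b, j) \<Rightarrow> x ^ (k - b) * y ^ b * (cnj x * cnj y) ^ j) * scaled_sib k i v" for i v
      using scaled_sib_torus[OF xy] by (cases i) simp
    show "\<exists>v. scaled_sib k i v \<noteq> 0" if "i \<in> I" for i
      using assms(1) that scaled_sib_neq_0[of "fst i" k "snd i"] by auto
  qed (use assms in auto)
qed

lemma inj_on_scaled_sib: "inj_on (scaled_sib k) ({..k} \<times> {..k})"
proof (rule inj_onI, rule ccontr)
  fix i i' assume i: "i \<in> {..k} \<times> {..k}" "i' \<in> {..k} \<times> {..k}" "scaled_sib k i = scaled_sib k i'" "i \<noteq> i'"
  have "(if i = i then 1 else - 1 :: complex) = 0"
    by (rule scaled_sib_independent[of "{i, i'}" k "\<lambda>n. if n = i then 1 else - 1"])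
       (use i in auto)
  then show False by simp
qed

lemma sum_fun_apply: "sum f A x = (\<Sum>a\<in>A. f a x)" for f :: "'a \<Rightarrow> 'b \<Rightarrow> 'c::comm_monoid_add"
  by (induction A rule: infinite_finite_induct) auto

lemma scaled_sib_image_sum:
  assumes "I \<subseteq> {..k} \<times> {..k}"
  shows "(\<Sum>w\<in>scaled_sib k ` I. fscale (u w) w) v = (\<Sum>i\<in>I. u (scaled_sib k i) * scaled_sib k i v)"
  unfolding sum.reindex[OF inj_on_subset[OF inj_on_scaled_sib assms]]
  by (simp add: sum_fun_apply fscale_def)

lemma independent_scaled_sib_image:
  assumes "I \<subseteq> {..k} \<times> {..k}"
  shows "\<not> fs.dependent (scaled_sib k ` I)"
proof
  have fin: "finite (scaled_sib k ` I)" using finite_subset[OF assms] by auto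
  assume "fs.dependent (scaled_sib k ` I)"
  then obtain u i where u: "i \<in> I" "u (scaled_sib k i) \<noteq> 0" "(\<Sum>w\<in>scaled_sib k ` I. fscale (u w) w) = 0"
    unfolding fs.dependent_finite[OF fin] by blast
  have "(\<Sum>i\<in>I. u (scaled_sib k i) * scaled_sib k i v) = 0" for v
    using scaled_sib_image_sum[OF assms, of u v] u(3) by simp
  then show False using scaled_sib_independent[OF assms _ u(1), of "\<lambda>i. u (scaled_sib k i)"] u(2) by blast
qed

text \<open>Writing b = c - h i turns 0 <= b <= K into bounds on i, and the formula is the length of
  that interval. The two quotients count the steps of size h from c down to 0 and from c up to
  K.\<close>

lemma card_bounded_residue_class:
  fixes h c :: int
  assumes "h > 0"
  shows "card {b::nat. b \<le> K \<and> h dvd c - int b} = nat (c div h + (int K - c) div h + 1)"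
proof -
  have mem: "- ((int K - c) div h) \<le> i \<and> i \<le> c div h \<longleftrightarrow> 0 \<le> c - h * i \<and> c - h * i \<le> int K" for i
  proof -
    have le_div: "i \<le> x div h \<longleftrightarrow> i * h \<le> x" for i x
    proof -
      have "i \<le> x div h \<longleftrightarrow> real_of_int i \<le> of_int x / of_int h"
        unfolding floor_divide_of_int_eq[symmetric, where 'a = real] le_floor_iff ..
      also have "\<dots> \<longleftrightarrow> real_of_int (i * h) \<le> of_int x" using assms by (simp add: pos_le_divide_eq)
      finally show ?thesis by (simp only: of_int_le_iff)
    qed
    have "i \<le> c div h \<longleftrightarrow> i * h \<le> c" by (rule le_div)
    moreover have "- i \<le> (int K - c) div h \<longleftrightarrow> - i * h \<le> int K - c" by (rule le_div)
    ultimately show ?thesis by (auto simp: algebra_simps)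
  qed
  have "{b::nat. b \<le> K \<and> h dvd c - int b} = (\<lambda>i. nat (c - h * i)) ` {- ((int K - c) div h)..c div h}" (is "?L = ?R")
  proof
    show "?L \<subseteq> ?R"
    proof
      fix b assume "b \<in> ?L"
      then obtain i where i: "b \<le> K" "c - int b = h * i" by auto
      then have "c - h * i = int b" by simp
      then show "b \<in> ?R" using i mem[of i] by (intro image_eqI[of _ _ i]) auto
    qed
    show "?R \<subseteq> ?L"
    proof
      fix b assume "b \<in> ?R"
      then obtain i where "0 \<le> c - h * i" "c - h * i \<le> int K" "b = nat (c - h * i)" using mem by auto
      then show "b \<in> ?L" by auto
    qed
  qed
  moreover have "inj_on (\<lambda>i. nat (c - h * i)) {- ((int K - c) div h)..c div h}"
    using mem assms by (intro inj_onI) (auto simp: eq_nat_nat_iff)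
  ultimately show ?thesis by (simp add: card_image algebra_simps)
qed

section \<open>Modes of the lens space\<close>

lemma subspace_modes: "fs.subspace (modes \<Gamma> k)"
proof (rule fs.subspaceI)
  show "0 \<in> modes \<Gamma> k" using S3_laplace_eigen_zero by (simp add: modes_def R_act_def)
  show "F + Q \<in> modes \<Gamma> k" if "F \<in> modes \<Gamma> k" "Q \<in> modes \<Gamma> k" for F Q
    using that S3_laplace_eigen_add[of F _ Q] unfolding modes_def R_act_def by simp
  show "fscale c F \<in> modes \<Gamma> k" if "F \<in> modes \<Gamma> k" for c F
    using that S3_laplace_eigen_fscale[of F] unfolding modes_def R_act_def by (simp add: fscale_def)
qed

section \<open>The action of the generator of Z_p\<close>

definition invariant_degrees :: "nat \<Rightarrow> nat \<Rightarrow> nat set" where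
  "invariant_degrees p k = {b. b \<le> k \<and> (int (k - b) - int b) mod int p = 0}"

lemma Zp_gen_eq: "Zp_gen p v = (cis (2 * pi / p) * fst v, cnj (cis (2 * pi / p)) * snd v)"
  by (simp add: Zp_gen_def cis_cnj)

lemma scaled_sib_Zp_gen:
  "scaled_sib k (b, j) (Zp_gen p v) = cis (2 * pi / p) ^ (k - b) * cnj (cis (2 * pi / p)) ^ b * scaled_sib k (b, j) v"
proof -
  let ?x = "cis (2 * pi / p)"
  have x: "?x * cnj ?x = 1" "cnj ?x * cnj (cnj ?x) = 1" by (simp_all add: cis_cnj cis_mult)
  show ?thesis unfolding Zp_gen_eq scaled_sib_torus[OF x] using x(2) by simp
qed

lemma cis_weight_eq_1_iff:
  assumes "p \<ge> 1"
  shows "cis (2 * pi / real p) ^ a * cnj (cis (2 * pi / real p)) ^ b = 1 \<longleftrightarrow> (int a - int b) mod int p = 0"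
proof -
  have eq: "cis (2 * pi / real p) ^ a * cnj (cis (2 * pi / real p)) ^ b = cis (2 * pi * (of_int (int a - int b) / real p))"
    unfolding cis_cnj Complex.DeMoivre cis_mult by (rule arg_cong[where f = cis]) (simp add: algebra_simps diff_divide_distrib)
  show ?thesis
  proof
    assume "cis (2 * pi / real p) ^ a * cnj (cis (2 * pi / real p)) ^ b = 1"
    then have "cos (2 * pi * (of_int (int a - int b) / real p)) = 1" unfolding eq by (simp add: complex_eq_iff)
    then obtain n :: int where "2 * pi * (of_int (int a - int b) / real p) = of_int n * 2 * pi"
      unfolding cos_one_2pi_int by blast
    moreover have "y = z" if "2 * pi * y = z * 2 * pi" for y z :: real using that by simp
    ultimately have "of_int (int a - int b) / real p = of_int n" by blast
    then have "of_int (int a - int b) = real_of_int (n * int p)" using assms by (simp add: field_simps)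
    then have "int a - int b = n * int p" by (simp only: of_int_eq_iff)
    then show "(int a - int b) mod int p = 0" by simp
  next
    assume "(int a - int b) mod int p = 0"
    then obtain n where "int a - int b = int p * n" by (auto simp: dvd_def mod_eq_0_iff_dvd)
    then have "of_int (int a - int b) / real p = of_int n" using assms by simp
    then show "cis (2 * pi / real p) ^ a * cnj (cis (2 * pi / real p)) ^ b = 1"
      unfolding eq by (simp add: cis_multiple_2pi)
  qed
qed

lemma bij_Zp_gen: "bij (Zp_gen p)"
proof (rule o_bij)
  define x where "x = cis (2 * pi / p)"
  have x: "x * cnj x = 1" "cnj x * x = 1" by (simp_all add: x_def cis_cnj cis_mult)
  show "(\<lambda>v. (cnj x * fst v, x * snd v)) \<circ> Zp_gen p = id" "Zp_gen p \<circ> (\<lambda>v. (cnj x * fst v, x * snd v)) = id"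
    unfolding Zp_gen_eq[abs_def] x_def[symmetric] using x by (auto simp: fun_eq_iff simp flip: mult.assoc)
qed

lemma Zp_gen_S3_iff: "Zp_gen p v \<in> S3 \<longleftrightarrow> v \<in> S3"
  unfolding Zp_gen_eq by (rule torus_S3_iff) (simp_all add: cis_cnj cis_mult)

lemma modes_Zp_gen:
  assumes "F \<in> modes (Zp p) k"
  shows "F (Zp_gen p v) = F v"
proof (cases "v \<in> S3")
  case True
  have "Zp_gen p \<in> Zp p" unfolding Zp_def by (auto intro: exI[of _ 1])
  \<comment> \<open>The action uses the inverse, so it is evaluated at the image point to obtain
    invariance under the generator itself.\<close>
  then have "F (inv (Zp_gen p) (Zp_gen p v)) = F (Zp_gen p v)"
    using assms True unfolding modes_def R_act_def by (simp add: Zp_gen_S3_iff)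
  then show ?thesis using bij_Zp_gen[of p] by (simp add: bij_def)
next
  case False
  have "F x = 0" if "x \<notin> S3" for x using assms that unfolding modes_def by blast
  then show ?thesis using False by (simp add: Zp_gen_S3_iff)
qed

lemma scaled_sib_in_modes:
  assumes "p \<ge> 1" "b \<in> invariant_degrees p k"
  shows "scaled_sib k (b, j) \<in> modes (Zp p) k"
  unfolding modes_def
proof (intro CollectI conjI allI impI ballI)
  have b: "b \<le> k" "(int (k - b) - int b) mod int p = 0" using assms(2) by (auto simp: invariant_degrees_def)
  show "scaled_sib k (b, j) x = 0" if "x \<notin> S3" for x
    using that by (simp add: scaled_sib_def fscale_def restrS3_def)
  show "S3_laplace_eigen (scaled_sib k (b, j)) (- of_nat (k * (k + 2)))"
    unfolding scaled_sib_def fst_conv snd_conv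
    using S3_laplace_eigen_sib[of "k - b" b j] b by (intro S3_laplace_eigen_fscale) simp
  fix \<gamma> x assume "\<gamma> \<in> Zp p"
  then obtain m where \<gamma>: "\<gamma> = Zp_gen p ^^ m" unfolding Zp_def by blast
  have "scaled_sib k (b, j) (Zp_gen p v) = scaled_sib k (b, j) v" for v
    using b cis_weight_eq_1_iff[OF assms(1), of "k - b" b] by (simp add: scaled_sib_Zp_gen)
  then have "scaled_sib k (b, j) ((Zp_gen p ^^ m) v) = scaled_sib k (b, j) v" for v
    by (induction m) simp_all
  then have "scaled_sib k (b, j) (\<gamma> (inv \<gamma> x)) = scaled_sib k (b, j) (inv \<gamma> x)" by (simp add: \<gamma>)
  moreover have "bij \<gamma>" unfolding \<gamma> by (rule bij_fn[OF bij_Zp_gen])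
  ultimately show "R_act \<gamma> (scaled_sib k (b, j)) x = scaled_sib k (b, j) x"
    by (simp add: R_act_def bij_is_surj surj_f_inv_f)
qed

lemma modes_eq_span:
  assumes "p \<ge> 1"
  shows "modes (Zp p) k = fs.span (scaled_sib k ` (invariant_degrees p k \<times> {..k}))" (is "_ = fs.span (_ ` ?J)")
proof
  show "fs.span (scaled_sib k ` ?J) \<subseteq> modes (Zp p) k"
    using scaled_sib_in_modes[OF assms] by (intro fs.span_minimal subspace_modes) auto
  let ?I = "{..k} \<times> {..k}"
  show "modes (Zp p) k \<subseteq> fs.span (scaled_sib k ` ?J)"
  proof
    fix F assume F: "F \<in> modes (Zp p) k"
    have "F \<in> fs.span {restrS3 (sib a b j) | a b j. a + b = k \<and> j \<le> k}"
      using F unfolding modes_def by (intro eigenfunction_in_sib_span) blast+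
    also have "\<dots> \<subseteq> fs.span (scaled_sib k ` ?I)"
    proof (rule fs.span_minimal[OF _ fs.subspace_span], rule subsetI)
      fix Q assume "Q \<in> {restrS3 (sib a b j) | a b j. a + b = k \<and> j \<le> k}"
      then obtain a b j where Q: "Q = restrS3 (sib a b j)" "a + b = k" "j \<le> k" by blast
      then have "Q = fscale (inverse (fact j)) (scaled_sib k (b, j))" by (auto simp: scaled_sib_def)
      moreover have "scaled_sib k (b, j) \<in> scaled_sib k ` ?I" using Q by auto
      ultimately show "Q \<in> fs.span (scaled_sib k ` ?I)" by (simp only: fs.span_scale fs.span_base)
    qed
    finally obtain u where u: "F = (\<Sum>w\<in>scaled_sib k ` ?I. fscale (u w) w)"
      using fs.span_finite[of "scaled_sib k ` ?I"] by auto
    define c where "c i = u (scaled_sib k i)" for i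
    have Fc: "F v = (\<Sum>i\<in>?I. c i * scaled_sib k i v)" for v
      unfolding u c_def by (rule scaled_sib_image_sum) simp
    define \<mu> where "\<mu> i = cis (2 * pi / real p) ^ (k - fst i) * cnj (cis (2 * pi / real p)) ^ fst i" for i :: "nat \<times> nat"
    \<comment> \<open>Expanding F composed with the generator multiplies each coefficient by its
      root of unity; independence of the full family then forces every coefficient with a root other
      than 1 to vanish.\<close>
    have "(\<Sum>i\<in>?I. c i * (\<mu> i - 1) * scaled_sib k i v) = 0" for v
    proof -
      have "(\<Sum>i\<in>?I. c i * (\<mu> i - 1) * scaled_sib k i v) = F (Zp_gen p v) - F v"
        unfolding Fc sum_subtractf[symmetric]
        by (intro sum.cong refl) (auto simp: scaled_sib_Zp_gen \<mu>_def algebra_simps)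
      then show ?thesis using modes_Zp_gen[OF F] by simp
    qed
    then have "c i * (\<mu> i - 1) = 0" if "i \<in> ?I" for i
      using scaled_sib_independent[of ?I k "\<lambda>i. c i * (\<mu> i - 1)" i] that by blast
    then have c0: "c i = 0" if "i \<in> ?I - ?J" for i
      using that cis_weight_eq_1_iff[OF assms, of "k - fst i" "fst i"]
      by (auto simp: \<mu>_def invariant_degrees_def)
    have J: "?J \<subseteq> ?I" by (auto simp: invariant_degrees_def)
    have "F = (\<Sum>i\<in>?J. fscale (c i) (scaled_sib k i))"
    proof
      fix v
      have "F v = (\<Sum>i\<in>?J. c i * scaled_sib k i v)"
        unfolding Fc by (rule sum.mono_neutral_right) (use J c0 in auto)
      then show "F v = (\<Sum>i\<in>?J. fscale (c i) (scaled_sib k i)) v" by (simp add: sum_fun_apply fscale_def)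
    qed
    then show "F \<in> fs.span (scaled_sib k ` ?J)"
      by (simp only:) (intro fs.span_sum fs.span_scale fs.span_base imageI)
  qed
qed

section \<open>Counting the invariant monomials\<close>

lemma card_invariant_degrees_even:
  assumes "p \<ge> 1" "even p" "even k"
  shows "int (card (invariant_degrees p k)) = 2 * \<lfloor>real k / real p\<rfloor> + 1"
proof -
  obtain m h where mh: "k = 2 * m" "p = 2 * h" using assms by (auto elim!: evenE)
  \<comment> \<open>The exponent difference is k - 2 b = 2 (m - b); its factor 2 cancels against the
    one in p, leaving a residue class modulo h centred at the midpoint m of 0..k.\<close>
  have iff: "(int (k - b) - int b) mod int p = 0 \<longleftrightarrow> int h dvd int m - int b" if "b \<le> k" for b
  proof -
    have "int (k - b) - int b = 2 * (int m - int b)" using that by (simp add: mh of_nat_diff)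
    then have "(int (k - b) - int b) mod int p = 0 \<longleftrightarrow> 2 * int h dvd 2 * (int m - int b)"
      by (simp only: mod_eq_0_iff_dvd mh of_nat_mult of_nat_numeral)
    then show ?thesis by (simp only: dvd_mult_cancel_left) simp
  qed
  then have "invariant_degrees p k = {b. b \<le> k \<and> int h dvd int m - int b}"
    unfolding invariant_degrees_def by (simp only: iff cong: conj_cong)
  then have "card (invariant_degrees p k) = nat (int m div int h + int m div int h + 1)"
    using card_bounded_residue_class[of "int h" k "int m"] assms(1) by (simp add: mh)
  moreover have "\<lfloor>real k / real p\<rfloor> = int m div int h"
    unfolding floor_divide_of_nat_eq by (simp add: mh zdiv_int)
  moreover have "int m div int h \<ge> 0" by (simp flip: zdiv_int)
  ultimately show ?thesis by simp
qed

text \<open>Again k - 2 b = 2 (m - b), but the 2 is now a unit modulo p, so the step between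
  admissible b is p instead of p/2.\<close>

lemma card_invariant_degrees_odd_even:
  assumes "odd p" "even k"
  shows "int (card (invariant_degrees p k)) = 2 * \<lfloor>real k / (2 * real p)\<rfloor> + 1"
proof -
  obtain m where m: "k = 2 * m" using assms by (auto elim!: evenE)
  have iff: "(int (k - b) - int b) mod int p = 0 \<longleftrightarrow> int p dvd int m - int b" if "b \<le> k" for b
  proof -
    have "int (k - b) - int b = 2 * (int m - int b)" using that by (simp add: m of_nat_diff)
    moreover have "coprime (int p) 2" using assms(1) by simp
    ultimately show ?thesis by (simp only: mod_eq_0_iff_dvd coprime_dvd_mult_right_iff)
  qed
  then have "invariant_degrees p k = {b. b \<le> k \<and> int p dvd int m - int b}"
    unfolding invariant_degrees_def by (simp only: iff cong: conj_cong)
  then have "card (invariant_degrees p k) = nat (int m div int p + int m div int p + 1)"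
    using card_bounded_residue_class[of "int p" k "int m"] assms(1) odd_pos[of p] by (simp add: m)
  moreover have "\<lfloor>real k / (2 * real p)\<rfloor> = int m div int p"
    using floor_divide_of_nat_eq[of m p, where 'a = real] by (simp add: m zdiv_int)
  moreover have "int m div int p \<ge> 0" by (simp flip: zdiv_int)
  ultimately show ?thesis by simp
qed

text \<open>As k is not even, the class is centred at m = (k - p)/2, an integer that may be
  negative, through k - 2 b = 2 (m - b) + p. Since k - m = m + p, the two quotients differ by one,
  which makes the count even.\<close>

lemma card_invariant_degrees_odd_odd:
  assumes "odd p" "odd k"
  shows "int (card (invariant_degrees p k)) = 2 * (\<lfloor>(real k - real p) / (2 * real p)\<rfloor> + 1)"
proof -
  have "even (int k - int p)" using assms by simp
  then obtain m where m: "int k - int p = 2 * m" by (elim evenE)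
  have p: "int p > 0" using odd_pos[OF assms(1)] by simp
  have iff: "(int (k - b) - int b) mod int p = 0 \<longleftrightarrow> int p dvd m - int b" if "b \<le> k" for b
  proof -
    have "int (k - b) - int b = 2 * (m - int b) + int p" using that m by (simp add: of_nat_diff)
    moreover have "coprime (int p) 2" using assms(1) by simp
    ultimately show ?thesis by (simp only: mod_eq_0_iff_dvd coprime_dvd_mult_right_iff dvd_add_triv_right_iff)
  qed
  then have "invariant_degrees p k = {b. b \<le> k \<and> int p dvd m - int b}"
    unfolding invariant_degrees_def by (simp only: iff cong: conj_cong)
  then have "card (invariant_degrees p k) = nat (m div int p + (int k - m) div int p + 1)"
    using card_bounded_residue_class[OF p, of k m] by simp
  moreover have "(int k - m) div int p = m div int p + 1"
  proof -
    have "int k - m = m + int p" using m by simp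
    then show ?thesis using p by simp
  qed
  moreover have "\<lfloor>(real k - real p) / (2 * real p)\<rfloor> = m div int p"
  proof -
    have "(real k - real p) / (2 * real p) = of_int (2 * m) / (2 * real p)"
      using arg_cong[OF m, of real_of_int] by simp
    then show ?thesis using floor_divide_of_int_eq[of m "int p", where 'a = real] by simp
  qed
  \<comment> \<open>For k < p the quotient is -1 and the count 0; this lower bound keeps
    \<open>nat\<close> from truncating.\<close>
  moreover have "m div int p \<ge> - 1"
  proof -
    have "- 1 * int p \<le> m" using m p by linarith
    then have "- 1 * int p div int p \<le> m div int p" using p by (rule zdiv_mono1)
    moreover have "- 1 * int p div int p = - 1" using p by (intro nonzero_mult_div_cancel_right) simp
    ultimately show ?thesis by simp
  qed
  ultimately show ?thesis by simp
qed

lemma invariant_degrees_even_odd: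
  assumes "even p" "odd k"
  shows "invariant_degrees p k = {}"
proof (rule equals0I)
  fix b assume "b \<in> invariant_degrees p k"
  then have b: "b \<le> k" "(int (k - b) - int b) mod int p = 0" by (simp_all only: invariant_degrees_def mem_Collect_eq)
  have "int p dvd int (k - b) - int b" using b(2) by (simp only: mod_eq_0_iff_dvd)
  moreover have "even (int p)" using assms(1) by simp
  ultimately have "even (int (k - b) - int b)" by (rule dvd_trans[rotated])
  then have "even (int k - 2 * int b)" using b(1) by (simp add: of_nat_diff)
  then show False using assms(2) by simp
qed

theorem theorem14p1:
  fixes p k :: nat
  assumes "p \<ge> 1"
  defines "B \<equiv> {restrS3 ((twist_minus ^^ j) (monomial a b)) | a b j.
                    a + b = k \<and> (int a - int b) mod int p = 0 \<and> j \<le> k}"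
  shows "\<not> module.dependent fscale B
         \<and> module.span fscale B = modes (Zp p) k
         \<and> (even p \<and> even k \<longrightarrow>
              int (vector_space.dim fscale (modes (Zp p) k))
                = (2 * \<lfloor>real k / real p\<rfloor> + 1) * (int k + 1))
         \<and> (even p \<and> odd k \<longrightarrow> vector_space.dim fscale (modes (Zp p) k) = 0)
         \<and> (odd p \<and> even k \<longrightarrow>
              int (vector_space.dim fscale (modes (Zp p) k))
                = (2 * \<lfloor>real k / (2 * real p)\<rfloor> + 1) * (int k + 1))
         \<and> (odd p \<and> odd k \<longrightarrow>
              int (vector_space.dim fscale (modes (Zp p) k))
                = 2 * (\<lfloor>(real k - real p) / (2 * real p)\<rfloor> + 1) * (int k + 1))
         \<and> (\<forall>n::nat. p = 2 * n \<longrightarrow>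
              (even k \<longrightarrow> int (vector_space.dim fscale (modes (Zp p) k))
                   = (2 * \<lfloor>(real k / 2) / real n\<rfloor> + 1) * (int k + 1))
              \<and> (odd k \<longrightarrow> vector_space.dim fscale (modes (Zp p) k) = 0))"
proof -
  let ?J = "invariant_degrees p k \<times> {..k}"
  have J: "?J \<subseteq> {..k} \<times> {..k}" by (auto simp: invariant_degrees_def)
  \<comment> \<open>The exponent a is determined by b, so the family is parametrized by pairs (b,
    j).\<close>
  have B: "B = scaled_sib k ` ?J"
  proof
    show "B \<subseteq> scaled_sib k ` ?J"
    proof
      fix F assume "F \<in> B"
      then obtain a b j where *: "F = restrS3 ((twist_minus ^^ j) (monomial a b))" "a + b = k"
          "(int a - int b) mod int p = 0" "j \<le> k" unfolding B_def by (elim CollectE exE conjE) (rule that)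
      then have "a = k - b" by simp
      with * have "F = scaled_sib k (b, j)" "(b, j) \<in> ?J" by (auto simp: scaled_sib_eq invariant_degrees_def)
      then show "F \<in> scaled_sib k ` ?J" by blast
    qed
    show "scaled_sib k ` ?J \<subseteq> B"
    proof (rule image_subsetI)
      fix i assume i: "i \<in> ?J"
      obtain b j where bj: "i = (b, j)" by (cases i)
      have "(k - b) + b = k \<and> (int (k - b) - int b) mod int p = 0 \<and> j \<le> k"
        using i by (auto simp: bj invariant_degrees_def)
      then show "scaled_sib k i \<in> B"
        unfolding B_def bj scaled_sib_eq[symmetric]
        by - (rule CollectI, rule exI[of _ "k - b"], rule exI[of _ b], rule exI[of _ j], rule conjI[OF refl])
    qed
  qed
  have ind: "\<not> fs.dependent B" unfolding B by (rule independent_scaled_sib_image[OF J])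
  have span: "fs.span B = modes (Zp p) k" unfolding B by (rule modes_eq_span[OF assms(1), symmetric])
  have dim: "fs.dim (modes (Zp p) k) = card (invariant_degrees p k) * (k + 1)"
  proof -
    have "fs.dim (modes (Zp p) k) = card B"
      unfolding span[symmetric] by (rule fs.dim_span_eq_card_independent[OF ind])
    \<comment> \<open>Injectivity of the parametrization matters here: coinciding siblings would
      lower the dimension.\<close>
    also have "card B = card ?J" unfolding B by (rule card_image[OF inj_on_subset[OF inj_on_scaled_sib J]])
    finally show ?thesis by (simp add: card_cartesian_product)
  qed
  have even: "int (fs.dim (modes (Zp p) k)) = (2 * \<lfloor>real k / real p\<rfloor> + 1) * (int k + 1)" if "even p" "even k"
    unfolding dim of_nat_mult card_invariant_degrees_even[OF assms(1) that] by simp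
  have zero: "fs.dim (modes (Zp p) k) = 0" if "even p" "odd k"
    unfolding dim invariant_degrees_even_odd[OF that] by simp
  have oe: "int (fs.dim (modes (Zp p) k)) = (2 * \<lfloor>real k / (2 * real p)\<rfloor> + 1) * (int k + 1)" if "odd p" "even k"
    unfolding dim of_nat_mult card_invariant_degrees_odd_even[OF that] by simp
  have oo: "int (fs.dim (modes (Zp p) k)) = 2 * (\<lfloor>(real k - real p) / (2 * real p)\<rfloor> + 1) * (int k + 1)" if "odd p" "odd k"
    unfolding dim of_nat_mult card_invariant_degrees_odd_odd[OF that] by simp
  have half: "(real k / 2) / real n = real k / real p" "even p" if "p = 2 * n" for n using that by simp_all
  show ?thesis
  proof (intro conjI allI impI)
    fix n assume n: "p = 2 * n"
    show "int (fs.dim (modes (Zp p) k)) = (2 * \<lfloor>(real k / 2) / real n\<rfloor> + 1) * (int k + 1)" if "even k"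
      unfolding half(1)[OF n] by (rule even[OF half(2)[OF n] that])
    show "fs.dim (modes (Zp p) k) = 0" if "odd k"
      by (rule zero[OF half(2)[OF n] that])
  qed (use ind span even zero oe oo in blast)+
qed

end
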